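(* Let $1<p,q<\infty$, let $B(\ell_p,\ell_q)$ be the Banach space of bounded linear operators from $\ell_p$ to $\ell_q$ with the operator norm, and let $T\in B(\ell_p,\ell_q)$ with $\|T\|=1$. Put $M_T=\{x\in S_{\ell_p}:\|Tx\|=\|T\|\}$. Then the following are equivalent. (i) The norm of $B(\ell_p,\ell_q)$ is strongly subdifferentiable at $T$. (ii) $M_T\neq\emptyset$, and for every maximizing sequence $\{x_n\}$ of $T$ there exists a subsequence $\{x_{n_i}\}$ of $\{x_n\}$ such that $d(x_{n_i},M_T)\to 0$.
   Context: Scalars are $\mathbb{F}\in\{\mathbb{R},\mathbb{C}\}$. For a Banach space $X$, $S_X$ and $B_X$ denote its unit sphere and closed unit ball. The norm of $X$ is strongly subdifferentiable at $u\in X$ if $\lim_{t\to0^+}\frac{\|u+tx\|-\|u\|}{t}=\max\{\operatorname{Re}f(x): f\in J_{X^*}(u)\}$ uniformly for $x\in B_X$, where $J_{X^*}(u)=\{f\in S_{X^*}: f(u)=\|u\|\}$. A maximizing sequence for a bounded linear operator $T:X\to Y$ is a sequence $\{x_n\}$ with $x_n\in S_X$ for all $n$ and $\|Tx_n\|\to\|T\|$. $d(x,M)$ denotes the norm distance from the point $x$ to the set $M$. *)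

theory Defs
  imports "HOL-Analysis.Analysis"
begin

text \<open>
  The exponent of a sequence space is a real number, so the spaces cannot be types.  A normed
  space over the scalar type \<open>'a\<close> is therefore given by an explicit carrier and its operations.
\<close>

record ('a, 'v) nspace =
  vcarrier :: "'v set"
  vadd :: "'v \<Rightarrow> 'v \<Rightarrow> 'v"
  vscale :: "'a \<Rightarrow> 'v \<Rightarrow> 'v"
  vnorm :: "'v \<Rightarrow> real"

definition unit_sphere :: "('a, 'v) nspace \<Rightarrow> 'v set" where
  "unit_sphere X = {x \<in> vcarrier X. vnorm X x = 1}"

definition unit_ball :: "('a, 'v) nspace \<Rightarrow> 'v set" where
  "unit_ball X = {x \<in> vcarrier X. vnorm X x \<le> 1}"

definition vdist :: "('a::ring_1, 'v) nspace \<Rightarrow> 'v \<Rightarrow> 'v \<Rightarrow> real" where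
  "vdist X x y = vnorm X (vadd X x (vscale X (- 1) y))"

text \<open>Only meaningful for nonempty \<open>M\<close>.\<close>

definition vdist_set :: "('a::ring_1, 'v) nspace \<Rightarrow> 'v \<Rightarrow> 'v set \<Rightarrow> real" where
  "vdist_set X x M = (INF m\<in>M. vdist X x m)"

definition scalar_space :: "('a::real_normed_field, 'a) nspace" where
  "scalar_space = \<lparr>vcarrier = UNIV, vadd = (+), vscale = (*), vnorm = norm\<rparr>"

definition ell :: "real \<Rightarrow> ('a::real_normed_field, nat \<Rightarrow> 'a) nspace" where
  "ell p = \<lparr>vcarrier = {x. summable (\<lambda>n. norm (x n) powr p)},
            vadd = (\<lambda>x y n. x n + y n),
            vscale = (\<lambda>c x n. c * x n),
            vnorm = (\<lambda>x. (\<Sum>n. norm (x n) powr p) powr (1 / p))\<rparr>"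

text \<open>
  Operators are required to be \<open>undefined\<close> outside the carrier of their domain (\<open>extensional\<close>), so
  that equality of HOL functions is equality of operators; \<open>restrict\<close> maintains this.
\<close>

definition bounded_ops ::
    "('a, 'v) nspace \<Rightarrow> ('a, 'w) nspace \<Rightarrow> ('v \<Rightarrow> 'w) set" where
  "bounded_ops X Y = {T \<in> vcarrier X \<rightarrow>\<^sub>E vcarrier Y.
     (\<forall>x\<in>vcarrier X. \<forall>y\<in>vcarrier X. T (vadd X x y) = vadd Y (T x) (T y)) \<and>
     (\<forall>c. \<forall>x\<in>vcarrier X. T (vscale X c x) = vscale Y c (T x)) \<and>
     (\<exists>K. \<forall>x\<in>vcarrier X. vnorm Y (T x) \<le> K * vnorm X x)}"

definition op_space ::
    "('a, 'v) nspace \<Rightarrow> ('a, 'w) nspace \<Rightarrow> ('a, 'v \<Rightarrow> 'w) nspace" where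
  "op_space X Y = \<lparr>vcarrier = bounded_ops X Y,
     vadd = (\<lambda>S T. \<lambda>x\<in>vcarrier X. vadd Y (S x) (T x)),
     vscale = (\<lambda>c T. \<lambda>x\<in>vcarrier X. vscale Y c (T x)),
     vnorm = (\<lambda>T. SUP x\<in>unit_ball X. vnorm Y (T x))\<rparr>"

definition dual_space ::
    "('a::real_normed_field, 'v) nspace \<Rightarrow> ('a, 'v \<Rightarrow> 'a) nspace" where
  "dual_space X = op_space X scalar_space"

text \<open>The real part, uniformly for real and complex scalars; see the two lemmas below.\<close>

definition re_part :: "'a::{real_normed_field, real_inner} \<Rightarrow> real" where
  "re_part z = z \<bullet> 1"

lemma re_part_real [simp]: "re_part (x::real) = x"
  by (simp add: re_part_def)

lemma re_part_complex [simp]: "re_part z = Re z"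
  by (simp add: re_part_def inner_complex_def)

definition norming_functionals ::
    "('a::real_normed_field, 'v) nspace \<Rightarrow> 'v \<Rightarrow> ('v \<Rightarrow> 'a) set" where
  "norming_functionals X u = {f \<in> unit_sphere (dual_space X). f u = of_real (vnorm X u)}"

text \<open>\<open>GREATEST\<close> is the maximum of a set of reals that need not be finite, as \<open>Max\<close> requires.\<close>

definition strongly_subdifferentiable ::
    "('a::{real_normed_field, real_inner}, 'v) nspace \<Rightarrow> 'v \<Rightarrow> bool" where
  "strongly_subdifferentiable X u \<longleftrightarrow>
     uniform_limit (unit_ball X)
       (\<lambda>t x. (vnorm X (vadd X u (vscale X (of_real t) x)) - vnorm X u) / t)
       (\<lambda>x. GREATEST r. r \<in> {re_part (f x) | f. f \<in> norming_functionals X u})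
       (at_right 0)"

definition norm_attaining_set ::
    "('a, 'v) nspace \<Rightarrow> ('a, 'w) nspace \<Rightarrow> ('v \<Rightarrow> 'w) \<Rightarrow> 'v set" where
  "norm_attaining_set X Y T = {x \<in> unit_sphere X. vnorm Y (T x) = vnorm (op_space X Y) T}"

definition maximizing_seq ::
    "('a, 'v) nspace \<Rightarrow> ('a, 'w) nspace \<Rightarrow> ('v \<Rightarrow> 'w) \<Rightarrow> (nat \<Rightarrow> 'v) \<Rightarrow> bool" where
  "maximizing_seq X Y T x \<longleftrightarrow>
     (\<forall>n. x n \<in> unit_sphere X) \<and> (\<lambda>n. vnorm Y (T (x n))) \<longlonglongrightarrow> vnorm (op_space X Y) T"

end

theory Submission
  imports Defs
begin

text \<open>
  Write \<open>\<tau>(S)\<close> for the right derivative of \<open>t \<mapsto> \<parallel>T + t S\<parallel>\<close> at \<open>0\<close>.  Strong subdifferentiability says that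
  this derivative is the maximum of \<open>Re f(S)\<close> over the norming functionals \<open>f\<close> of \<open>T\<close>, and that it is
  approached uniformly for \<open>S\<close> in the unit ball.  Let \<open>j\<^sub>x\<close> be the norming functional of a unit vector
  \<open>x\<close> of \<open>\<ell>\<^sub>p\<close>, given by the coefficients \<open>|x(i)|\<^sup>p / x(i)\<close>, and let \<open>M\<close> be the set of unit vectors at which
  \<open>T\<close> attains its norm.

  From (i) to (ii).  For a maximizing sequence \<open>(x\<^sub>n)\<close> test the derivative on the rank one operators
  \<open>S\<^sub>n y = j\<^bsub>x\<^sub>n\<^esub>(y) T x\<^sub>n\<close>.  Evaluating at \<open>x\<^sub>n\<close> gives \<open>\<parallel>T + t S\<^sub>n\<parallel> \<ge> (1 + t) \<parallel>T x\<^sub>n\<parallel>\<close>, so uniformity forces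
  \<open>\<tau>(S\<^sub>n) \<rightarrow> 1\<close>.  Now fix \<open>n\<close> and let \<open>u\<^sub>k\<close> almost norm \<open>T + t\<^sub>k S\<^sub>n\<close> with \<open>t\<^sub>k \<rightarrow> 0\<close>.  Then \<open>(u\<^sub>k)\<close> is maximizing
  for \<open>T\<close>, and along a subsequence it converges weakly, that is coordinatewise, to some \<open>z\<close> with
  \<open>|j\<^bsub>x\<^sub>n\<^esub>(z)| \<ge> \<tau>(S\<^sub>n) > 0\<close>.  The decisive fact (\<open>ell_norm_weak_limit_maximizing\<close>) is that
  \<open>\<parallel>T z\<parallel> = \<parallel>z\<parallel>\<close> for such a weak limit, so that \<open>z / \<parallel>z\<parallel>\<close> lies in \<open>M\<close>; uniform convexity of \<open>\<ell>\<^sub>p\<close> then places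
  a scalar multiple of it close to \<open>x\<^sub>n\<close>.

  The decisive fact rests on the Brezis-Lieb splitting \<open>\<parallel>z + w\<^sub>k\<parallel>\<^sup>p - \<parallel>w\<^sub>k\<parallel>\<^sup>p \<rightarrow> \<parallel>z\<parallel>\<^sup>p\<close> for weakly null \<open>(w\<^sub>k)\<close>
  (\<open>ell_brezis_lieb\<close>).  If \<open>p \<le> q\<close>, splitting the norms of \<open>u\<^sub>k = z + w\<^sub>k\<close> in \<open>\<ell>\<^sub>p\<close> and of \<open>T u\<^sub>k\<close> in \<open>\<ell>\<^sub>q\<close>
  yields \<open>1 - \<parallel>T z\<parallel>\<^sup>q \<le> (1 - \<parallel>z\<parallel>\<^sup>p)\<^bsup>q/p\<^esup> \<le> 1 - \<parallel>z\<parallel>\<^sup>q\<close>.  If \<open>q < p\<close>, Pitt's theorem gives \<open>T w\<^sub>k \<rightarrow> 0\<close> in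
  norm.  The argument for Pitt's theorem (\<open>pitt_vanishing_on_null_seq\<close>) is stated for positively
  homogeneous functions, since it also shows that functionals on \<open>\<ell>\<^sub>p\<close> vanish along weakly null
  sequences, which is what makes \<open>T\<close> continuous for coordinatewise convergence of bounded sequences.

  From (ii) to (i).  Every \<open>m \<in> M\<close> gives the norming functional \<open>S \<mapsto> j\<^bsub>Tm\<^esub>(S m)\<close>.  Let \<open>\<sigma>(S)\<close> be the
  supremum of the real parts of these values.  It need not be attained at a point of \<open>M\<close>, but a cluster
  point of such functionals, which exists by Tychonoff's theorem, is a norming functional attaining it
  (\<open>support_attained\<close>).  By (ii), a vector almost norming \<open>T + t S\<close> for small \<open>t\<close> is close to some \<open>m \<in> M\<close>,
  and uniform smoothness of \<open>\<ell>\<^sub>q\<close> bounds the difference quotient by \<open>\<sigma>(S) + e\<close> uniformly in \<open>S\<close>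
  (\<open>diff_quot_le_support\<close>).  The reverse bound holds for every norming functional, so \<open>\<sigma>(S)\<close> is both the
  derivative and the maximum.

  Real and complex scalars are handled together as a normed field which is a Euclidean space.
\<close>

section \<open>Powers of the absolute value\<close>

lemma exp_gt_one_plus: "1 + x < exp x" if "x \<noteq> 0" for x :: real
proof -
  have "1 + x/2 \<le> exp (x/2)" by simp
  show ?thesis
  proof (cases "1 + x \<le> 0")
    case True then show ?thesis using exp_gt_zero[of x] by linarith
  next
    case False
    then have "(1 + x/2)^2 \<le> (exp (x/2))^2" using \<open>1 + x/2 \<le> exp (x/2)\<close>
      by (intro power_mono) auto
    also have "(exp (x/2))^2 = exp x" by (simp add: exp_double[symmetric])
    finally show ?thesis using that by (simp add: power2_eq_square field_simps)
       (smt (verit) not_real_square_gt_zero)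
  qed
qed

text \<open>
  Strict convexity of the exponential function, used at \<open>p ln w\<close> and \<open>0\<close> against the tangent at
  \<open>ln w\<close>.
\<close>

lemma powr_bernoulli_strict:
  fixes p w :: real
  assumes "1 < p" "0 \<le> w" "w \<noteq> 1"
  shows "1 + p * (w - 1) < w powr p"
proof (cases "w = 0")
  case True then show ?thesis using assms by simp
next
  case False
  define b where "b = ln w"
  have w: "w = exp b" using False assms by (simp add: b_def)
  have b: "b \<noteq> 0" using assms w by auto
  have e: "exp (b * (p - 1)) > 1 + b * (p - 1)" and e': "exp (- b) > 1 - b"
    using exp_gt_one_plus[of "b * (p - 1)"] exp_gt_one_plus[of "-b"] b assms by auto
  have "(p - 1) * exp b * exp (-b) > (p - 1) * exp b * (1 - b)"
    by (rule mult_strict_left_mono) (use e' assms in auto)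
  then have 1: "(p - 1) * exp b * (1 - b) < p - 1" by (simp add: mult.assoc flip: exp_add)
  have "exp b * exp (b * (p - 1)) > exp b * (1 + b * (p - 1))"
    by (rule mult_strict_left_mono) (use e in auto)
  then have "exp (b * p) > exp b * (1 + b * (p - 1))"
    by (simp add: algebra_simps flip: exp_add)
  moreover have "w powr p = exp (b * p)" using w by (simp add: powr_def mult.commute)
  ultimately show ?thesis using 1 w by (simp add: algebra_simps)
qed

lemma powr_bernoulli:
  fixes p w :: real
  assumes "1 < p" "0 \<le> w"
  shows "1 + p * (w - 1) \<le> w powr p"
  using powr_bernoulli_strict[OF assms] by (cases "w = 1") auto

text \<open>
  Young's inequality for conjugate exponents, with the strictness from which the strict
  convexity of \<open>|\<cdot>|\<^sup>p\<close> follows. It is Bernoulli's inequality for \<open>u / v\<close>.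
\<close>

lemma powr_young_strict:
  fixes p u v :: real
  assumes "1 < p" "0 \<le> u" "0 \<le> v" "u \<noteq> v"
  shows "p * (v powr (p - 1) * u) < u powr p + (p - 1) * v powr p"
proof (cases "v = 0")
  case True then show ?thesis using assms by simp
next
  case False
  then have v: "v > 0" using assms by simp
  have "1 + p * (u / v - 1) < (u / v) powr p"
    by (rule powr_bernoulli_strict) (use assms v in auto)
  then have "v powr p * (1 + p * (u / v - 1)) < v powr p * ((u / v) powr p)"
    using v by (intro mult_strict_left_mono) auto
  also have "\<dots> = u powr p" using v assms by (simp add: powr_divide)
  finally have "v powr p * (1 + p * (u / v - 1)) < u powr p" .
  moreover have "v powr p = v powr (p - 1) * v" using v by (simp add: powr_diff)
  then have "v powr p * (1 + p * (u / v - 1)) = p * (v powr (p - 1) * u) - (p - 1) * v powr p"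
    using v by (simp add: algebra_simps)
  ultimately show ?thesis by linarith
qed

lemma powr_young:
  fixes p u v :: real
  assumes "1 < p" "0 \<le> u" "0 \<le> v"
  shows "p * (v powr (p - 1) * u) \<le> u powr p + (p - 1) * v powr p"
proof (cases "u = v")
  case True
  have "v powr (p - 1) * v = v powr p" using assms by (cases "v = 0") (auto simp: powr_diff)
  then show ?thesis using True by (simp add: algebra_simps)
qed (use powr_young_strict[OF assms] in auto)

lemma powr_root: "(r powr p) powr (1 / p) = r" if "0 \<le> r" "1 < p" for r p :: real
  using that by (simp add: powr_powr)

lemma re_part_add: "re_part (x + y) = re_part x + re_part y"
  and re_part_diff: "re_part (x - y) = re_part x - re_part y"
  and re_part_scaleR: "re_part (r *\<^sub>R x) = r * re_part x"
  by (simp_all add: re_part_def inner_simps)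

lemma re_part_0 [simp]: "re_part 0 = 0"
  by (simp add: re_part_def)

lemma re_part_of_real [simp]: "re_part (of_real r :: 'a::{real_normed_field, real_inner}) = r"
  by (simp add: re_part_def of_real_def flip: power2_norm_eq_inner)

lemma re_part_le_norm: "re_part z \<le> norm z"
  using norm_cauchy_schwarz[of z 1] by (simp add: re_part_def)

lemma bounded_linear_re_part: "bounded_linear re_part"
  unfolding re_part_def by (rule bounded_linear_inner_left)

text \<open>
  The equality case of the Cauchy-Schwarz inequality against the unit.
\<close>

lemma re_part_eq_normD: "z = of_real (norm z)" if "re_part z = norm z" for z :: "'a::{real_normed_field, real_inner}"
proof -
  have n: "z \<bullet> z = (norm z)\<^sup>2" "(1::'a) \<bullet> 1 = 1"
    using power2_norm_eq_inner[of z] power2_norm_eq_inner[of "1::'a"] by simp_all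
  have "(norm (z - of_real (norm z)))\<^sup>2 = (norm z)\<^sup>2 - 2 * norm z * re_part z + (norm z)\<^sup>2"
    unfolding power2_norm_eq_inner[of "z - of_real (norm z)"]
    by (simp add: of_real_def inner_simps re_part_def inner_commute[of 1 z] n
         power2_eq_square algebra_simps)
  then show ?thesis using that by (simp add: power2_eq_square)
qed

text \<open>
  For complex \<open>a\<close> this is \<open>|a|\<^bsup>p-2\<^esup>\<close> times the conjugate of \<open>a\<close>, so that
  \<open>c \<mapsto> p Re (dual_coeff p a * c)\<close> is the derivative of \<open>|\<cdot>|\<^sup>p\<close> at \<open>a\<close>. Dividing by \<open>a\<close> avoids
  conjugation, which makes the formula meaningful for real and complex scalars alike; division
  by \<open>0\<close> gives the correct value \<open>0\<close>.
\<close>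

definition dual_coeff :: "real \<Rightarrow> 'a::real_normed_field \<Rightarrow> 'a" where
  "dual_coeff p a = of_real (norm a powr p) / a"

lemma norm_dual_coeff: "norm (dual_coeff p a) = norm a powr (p - 1)"
  by (cases "a = 0") (auto simp: dual_coeff_def norm_divide powr_diff)

lemma dual_coeff_mult_self: "dual_coeff p a * a = of_real (norm a powr p)"
  by (cases "a = 0") (auto simp: dual_coeff_def)

lemma dual_coeff_scale:
  "dual_coeff p (of_real r * a) = of_real (r powr (p - 1)) * dual_coeff p a" if "0 \<le> r"
  using that by (cases "r = 0")
    (auto simp: dual_coeff_def norm_mult powr_mult powr_diff field_simps)

lemma continuous_dual_coeff:
  assumes "1 < p"
  shows "continuous_on UNIV (dual_coeff p :: 'a::real_normed_field \<Rightarrow> 'a)"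
proof -
  have "isCont (dual_coeff p) a" for a :: 'a
  proof (cases "a = 0")
    case False
    then show ?thesis unfolding dual_coeff_def
      by (intro continuous_intros) auto
  next
    case True
    have "((\<lambda>a::'a. norm a powr (p - 1)) \<longlongrightarrow> 0) (at 0)"
      using assms by (intro tendsto_eq_intros | simp)+
    then have "((\<lambda>a::'a. dual_coeff p a) \<longlongrightarrow> 0) (at 0)"
      by (subst tendsto_norm_zero_iff[symmetric]) (simp add: norm_dual_coeff)
    moreover have "dual_coeff p (0 :: 'a) = 0" by (simp add: dual_coeff_def)
    ultimately show ?thesis unfolding isCont_def True by simp
  qed
  then show ?thesis by (simp add: continuous_at_imp_continuous_on)
qed

text \<open>
  The Bregman distance of \<open>|\<cdot>|\<^sup>p\<close>, that is the gap
  \<open>|c|\<^sup>p - |a|\<^sup>p - p Re (dual_coeff p a * (c - a))\<close> between the function at \<open>c\<close> and its tangent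
  at \<open>a\<close>.
\<close>

definition bregman :: "real \<Rightarrow> 'a::{real_normed_field, real_inner} \<Rightarrow> 'a \<Rightarrow> real" where
  "bregman p a c = norm c powr p + (p - 1) * norm a powr p - p * re_part (dual_coeff p a * c)"

lemma re_dual_coeff_le: "re_part (dual_coeff p a * c) \<le> norm a powr (p - 1) * norm c"
  using re_part_le_norm[of "dual_coeff p a * c"] by (simp add: norm_mult norm_dual_coeff)

lemma bregman_nonneg: "0 \<le> bregman p a c" if "1 < p"
proof -
  have "p * re_part (dual_coeff p a * c) \<le> p * (norm a powr (p - 1) * norm c)"
    using that re_dual_coeff_le by (intro mult_left_mono) auto
  moreover have "p * (norm a powr (p - 1) * norm c) \<le> norm c powr p + (p - 1) * norm a powr p"
    using that by (intro powr_young) auto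
  ultimately show ?thesis unfolding bregman_def by linarith
qed

text \<open>
  If the gap vanishes, then Young's inequality is an equality, so \<open>|c| = |a|\<close>, and the real part
  of \<open>dual_coeff p a * c\<close> equals its modulus, so \<open>c\<close> has the same argument as \<open>a\<close>.
\<close>

lemma bregman_pos:
  assumes "1 < p" "a \<noteq> c"
  shows "0 < bregman p a c"
proof (rule ccontr)
  assume "\<not> 0 < bregman p a c"
  then have z: "bregman p a c \<le> 0" by simp
  have le: "p * re_part (dual_coeff p a * c) \<le> p * (norm a powr (p - 1) * norm c)"
    using assms re_dual_coeff_le by (intro mult_left_mono) auto
  have eq: "norm c = norm a"
  proof (rule ccontr)
    assume "norm c \<noteq> norm a"
    then have "p * (norm a powr (p - 1) * norm c) < norm c powr p + (p - 1) * norm a powr p"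
      using assms by (intro powr_young_strict) auto
    then show False using le z unfolding bregman_def by linarith
  qed
  then have "a \<noteq> 0" using assms by auto
  have "norm a powr (p - 1) * norm a = norm a powr p"
    using \<open>a \<noteq> 0\<close> by (simp add: powr_diff)
  then have n: "norm (dual_coeff p a * c) = norm a powr p"
    by (simp add: norm_mult norm_dual_coeff eq)
  have "p * norm a powr p \<le> p * re_part (dual_coeff p a * c)"
    using z eq by (simp add: bregman_def algebra_simps)
  then have "re_part (dual_coeff p a * c) = norm (dual_coeff p a * c)"
    using assms re_part_le_norm[of "dual_coeff p a * c"] n by simp
  then have "dual_coeff p a * c = of_real (norm a powr p)"
    using re_part_eq_normD n by metis
  then show False using \<open>a \<noteq> 0\<close> assms by (simp add: dual_coeff_def field_simps)
qed

lemma bregman_scale: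
  "bregman p (of_real r * a) (of_real r * c) = r powr p * bregman p a c" if "0 \<le> r" "1 < p"
proof -
  have r: "r powr (p - 1) * r = r powr p" using that by (cases "r = 0") (auto simp: powr_diff)
  have "dual_coeff p (of_real r * a) * (of_real r * c) = (r powr p) *\<^sub>R (dual_coeff p a * c)"
    unfolding dual_coeff_scale[OF that(1)] r[symmetric] by (simp add: scaleR_conv_of_real mult_ac)
  then show ?thesis using that
    by (simp add: bregman_def norm_mult powr_mult re_part_scaleR algebra_simps)
qed

text \<open>
  The scalar form of uniform convexity. By homogeneity it suffices to consider \<open>|a|, |c| \<le> 1\<close>.
  There either \<open>|a - c|\<^sup>p\<close> is below \<open>e\<close>, or the pair lies in a compact set on which the Bregman
  distance is continuous and positive, hence bounded below.
\<close>

lemma norm_diff_powr_le_bregman: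
  assumes p: "1 < p" and e: "0 < e"
  shows "\<exists>K\<ge>0. \<forall>a c :: 'a::{real_normed_field, euclidean_space}.
    norm (a - c) powr p \<le> e * (norm a powr p + norm c powr p) + K * bregman p a c"
proof -
  define B where "B = (cball 0 1 \<times> cball 0 1) \<inter> {z :: 'a \<times> 'a. e \<le> norm (fst z - snd z) powr p}"
  have "closed {z :: 'a \<times> 'a. e \<le> norm (fst z - snd z) powr p}"
    by (intro closed_Collect_le continuous_on_powr' continuous_intros) (use p in auto)
  then have cB: "compact B" unfolding B_def
    by (intro compact_Int_closed compact_Times compact_cball)
  have cont: "continuous_on B (\<lambda>z. bregman p (fst z) (snd z))"
    unfolding bregman_def using p
    by (intro continuous_on_powr' continuous_intros bounded_linear.continuous_on[OF bounded_linear_re_part]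
        continuous_on_compose2[OF continuous_dual_coeff[OF p]]) auto
  have "\<exists>d>0. \<forall>z\<in>B. d \<le> bregman p (fst z) (snd z)"
  proof (cases "B = {}")
    case False
    obtain z0 where z0: "z0 \<in> B" "\<And>z. z \<in> B \<Longrightarrow> bregman p (fst z0) (snd z0) \<le> bregman p (fst z) (snd z)"
      using continuous_attains_inf[OF cB False cont] by blast
    have "fst z0 \<noteq> snd z0" using z0(1) e by (auto simp: B_def)
    then show ?thesis using z0 bregman_pos[OF p] by blast
  qed (auto intro: exI[of _ 1])
  then obtain d where d: "d > 0" "\<And>z. z \<in> B \<Longrightarrow> d \<le> bregman p (fst z) (snd z)" by blast
  define K where "K = 2 powr p / d"
  have unit: "norm (a - c) powr p \<le> e + K * bregman p a c" if "norm a \<le> 1" "norm c \<le> 1" for a c :: 'a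
  proof (cases "e \<le> norm (a - c) powr p")
    case True
    then have "d \<le> bregman p a c" using d(2)[of "(a, c)"] that by (auto simp: B_def)
    then have "K * d \<le> K * bregman p a c" using d by (intro mult_left_mono) (auto simp: K_def)
    moreover have "norm (a - c) powr p \<le> 2 powr p"
      using that norm_triangle_ineq4[of a c] p by (intro powr_mono2) auto
    ultimately show ?thesis using d e by (simp add: K_def)
  next
    case False
    moreover have "0 \<le> K * bregman p a c"
    using d bregman_nonneg[OF p] unfolding K_def by (intro mult_nonneg_nonneg) auto
    ultimately show ?thesis by simp
  qed
  show ?thesis
  proof (intro exI conjI allI)
    show "0 \<le> K" using d by (simp add: K_def)
    fix a c :: 'a
    define r where "r = max (norm a) (norm c)"
    show "norm (a - c) powr p \<le> e * (norm a powr p + norm c powr p) + K * bregman p a c"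
    proof (cases "r = 0")
      case True
      then have "a = 0" "c = 0" unfolding r_def by (metis max.cobounded1 max.cobounded2 norm_le_zero_iff)+
      then show ?thesis using p by (simp add: bregman_def dual_coeff_def)
    next
      case False
      then have r: "r > 0" unfolding r_def by (simp add: less_max_iff_disj max_def split: if_splits)
      define a' c' where "a' = of_real (1/r) * a" and "c' = of_real (1/r) * c"
      have ac: "a = of_real r * a'" "c = of_real r * c'" using r by (auto simp: a'_def c'_def)
      have "norm a' \<le> 1" "norm c' \<le> 1" using r
        by (auto simp: a'_def c'_def norm_mult r_def norm_divide divide_simps)
      then have "r powr p * norm (a' - c') powr p \<le> r powr p * (e + K * bregman p a' c')"
        by (intro mult_left_mono unit) auto
      moreover have "norm (a - c) powr p = r powr p * norm (a' - c') powr p"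
        using r by (simp add: ac norm_mult powr_mult flip: right_diff_distrib)
      moreover have "bregman p a c = r powr p * bregman p a' c'"
        using r p by (simp add: ac bregman_scale)
      moreover have "r powr p \<le> norm a powr p + norm c powr p"
        by (auto simp: r_def max_def)
      then have "e * r powr p \<le> e * (norm a powr p + norm c powr p)"
        using e by (intro mult_left_mono) auto
      ultimately show ?thesis by (simp add: algebra_simps)
    qed
  qed
qed

text \<open>
  The scalar form of uniform smoothness. The tangent at \<open>a + s b\<close> lies below \<open>|\<cdot>|\<^sup>p\<close>, so the
  error of linearization at \<open>a\<close> is at most \<open>p s\<close> times
  \<open>|dual_coeff p (a + s b) - dual_coeff p a| |b|\<close>. This is small by uniform continuity of
  \<open>dual_coeff p\<close> on a compact ball and homogeneity.
\<close>

lemma norm_add_powr_le_linear: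
  assumes p: "1 < p" and e: "0 < e"
  shows "\<exists>s>0. \<forall>a b :: 'a::{real_normed_field, euclidean_space}.
    norm (a + of_real s * b) powr p \<le>
      norm a powr p + p * s * re_part (dual_coeff p a * b) + p * s * e * (norm a powr p + norm b powr p)"
proof -
  have "uniformly_continuous_on (cball (0::'a) 2) (dual_coeff p)"
    by (intro compact_uniformly_continuous continuous_on_subset[OF continuous_dual_coeff[OF p]]) auto
  then obtain d where d: "d > 0" and
    dd: "\<And>x y :: 'a. norm x \<le> 2 \<Longrightarrow> norm y \<le> 2 \<Longrightarrow> dist x y < d \<Longrightarrow> dist (dual_coeff p x) (dual_coeff p y) < e"
    unfolding uniformly_continuous_on_def using e by (metis mem_cball_0)
  define s where "s = min 1 (d/2)"
  have s: "0 < s" "s \<le> 1" "s < d" using d by (auto simp: s_def)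
  have unit: "norm (dual_coeff p (a + of_real s * b) - dual_coeff p a) \<le> e"
    if "norm a \<le> 1" "norm b \<le> 1" for a b :: 'a
  proof -
    have sb: "norm (of_real s * b) \<le> s" using that s by (simp add: norm_mult mult_left_le)
    have "dist (dual_coeff p (a + of_real s * b)) (dual_coeff p a) < e"
      using norm_triangle_ineq[of a "of_real s * b"] that s sb
      by (intro dd) (auto simp: dist_norm)
    then show ?thesis by (simp add: dist_norm)
  qed
  show ?thesis
  proof (intro exI conjI allI)
    show "0 < s" by (rule s)
    fix a b :: 'a
    define r where "r = max (norm a) (norm b)"
    define v where "v = a + of_real s * b"
    have diff: "norm (dual_coeff p v - dual_coeff p a) * norm b \<le> e * (norm a powr p + norm b powr p)"
    proof (cases "r = 0")
      case True
      then have "norm b = 0" unfolding r_def by (metis max.cobounded2 norm_le_zero_iff norm_zero)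
      then show ?thesis using e by simp
    next
      case False
      then have r: "r > 0" unfolding r_def by (simp add: less_max_iff_disj max_def split: if_splits)
      define a' b' where "a' = of_real (1/r) * a" and "b' = of_real (1/r) * b"
      have ab: "a = of_real r * a'" "b = of_real r * b'" using r by (auto simp: a'_def b'_def)
      have n: "norm a' \<le> 1" "norm b' \<le> 1" using r
        by (auto simp: a'_def b'_def norm_mult r_def norm_divide divide_simps)
      have v: "v = of_real r * (a' + of_real s * b')" by (simp add: v_def ab algebra_simps)
      have "norm (dual_coeff p v - dual_coeff p a)
          = r powr (p - 1) * norm (dual_coeff p (a' + of_real s * b') - dual_coeff p a')"
        unfolding v ab(1) using r by (simp add: dual_coeff_scale norm_mult flip: right_diff_distrib)
      also have "\<dots> \<le> r powr (p - 1) * e" using unit[OF n] by (intro mult_left_mono) auto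
      finally have "norm (dual_coeff p v - dual_coeff p a) * norm b \<le> r powr (p - 1) * e * r"
        using r e by (intro mult_mono) (auto simp: r_def)
      also have "\<dots> = e * r powr p" using r by (simp add: powr_diff)
      also have "\<dots> \<le> e * (norm a powr p + norm b powr p)"
        using e by (intro mult_left_mono) (auto simp: r_def max_def)
      finally show ?thesis .
    qed
    \<comment> \<open>The tangent inequality at the point v, evaluated at a.\<close>
    have "0 \<le> bregman p v a" by (rule bregman_nonneg[OF p])
    moreover have "dual_coeff p v * a = of_real (norm v powr p) - of_real s * (dual_coeff p v * b)"
      by (simp add: v_def algebra_simps flip: dual_coeff_mult_self)
    then have "re_part (dual_coeff p v * a) = norm v powr p - s * re_part (dual_coeff p v * b)"
      by (simp add: re_part_diff re_part_scaleR flip: scaleR_conv_of_real)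
    then have "s * re_part (dual_coeff p v * b) = norm v powr p - re_part (dual_coeff p v * a)"
      by simp
    ultimately have "norm v powr p \<le> norm a powr p + p * (s * re_part (dual_coeff p v * b))"
      by (simp add: bregman_def right_diff_distrib left_diff_distrib)
    also have "re_part (dual_coeff p v * b)
        = re_part (dual_coeff p a * b) + re_part ((dual_coeff p v - dual_coeff p a) * b)"
      by (simp add: re_part_diff algebra_simps)
    also have "p * (s * (re_part (dual_coeff p a * b) + re_part ((dual_coeff p v - dual_coeff p a) * b)))
       \<le> p * (s * (re_part (dual_coeff p a * b) + e * (norm a powr p + norm b powr p)))"
      using p s diff re_part_le_norm[of "(dual_coeff p v - dual_coeff p a) * b"]
      by (intro mult_left_mono add_left_mono) (auto simp: norm_mult)
    finally show "norm (a + of_real s * b) powr p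
         \<le> norm a powr p + p * s * re_part (dual_coeff p a * b) + p * s * e * (norm a powr p + norm b powr p)"
      by (simp add: v_def algebra_simps)
  qed
qed

text \<open>
  The scalar inequality behind the Brezis-Lieb splitting: if \<open>|a|\<close> is small compared with \<open>|b|\<close>,
  then \<open>|a + b|\<^sup>p\<close> differs from \<open>|b|\<^sup>p\<close> by a small multiple of \<open>|b|\<^sup>p\<close>; otherwise both are
  controlled by \<open>|a|\<^sup>p\<close>.
\<close>

lemma norm_add_powr_diff_le:
  assumes p: "1 < p" and e: "0 < e"
  shows "\<exists>K\<ge>0. \<forall>a b :: 'a::real_normed_vector.
       \<bar>norm (a + b) powr p - norm b powr p\<bar> \<le> e * norm b powr p + K * norm a powr p"
proof -
  have "isCont (\<lambda>x::real. x powr p) 1" using p by (intro continuous_intros) auto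
  then obtain d where d: "d > 0" and dd: "\<And>x. dist x 1 < d \<Longrightarrow> dist (x powr p) (1 powr p) < e"
    unfolding continuous_at_eps_delta using e by metis
  define h where "h = min (1/2) (d/2)"
  have h: "0 < h" "h < 1" "h < d" using d by (auto simp: h_def)
  define K where "K = (1 + 1/h) powr p"
  show ?thesis
  proof (intro exI conjI allI)
    show "0 \<le> K" by (simp add: K_def)
    fix a b :: 'a
    show "\<bar>norm (a + b) powr p - norm b powr p\<bar> \<le> e * norm b powr p + K * norm a powr p"
    proof (cases "norm a \<le> h * norm b")
      case True
      have "norm (a + b) \<le> (1 + h) * norm b" "(1 - h) * norm b \<le> norm (a + b)"
        using norm_triangle_ineq[of a b] norm_triangle_ineq2[of b "-a"] True
        by (auto simp: algebra_simps)
      then have "norm (a + b) powr p \<le> (1 + h) powr p * norm b powr p"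
        "(1 - h) powr p * norm b powr p \<le> norm (a + b) powr p"
        using h p by (auto simp flip: powr_mult intro!: powr_mono2)
      moreover have "(1 + h) powr p \<le> 1 + e" "1 - e \<le> (1 - h) powr p"
        using dd[of "1 + h"] dd[of "1 - h"] h by (auto simp: dist_real_def abs_if split: if_splits)
      then have "(1 + h) powr p * norm b powr p \<le> (1 + e) * norm b powr p"
         "(1 - e) * norm b powr p \<le> (1 - h) powr p * norm b powr p"
        by (auto intro: mult_right_mono)
      ultimately have "\<bar>norm (a + b) powr p - norm b powr p\<bar> \<le> e * norm b powr p"
        by (simp add: algebra_simps)
      moreover have "0 \<le> K * norm a powr p" by (simp add: K_def)
      ultimately show ?thesis by linarith
    next
      case False
      then have b: "norm b \<le> norm a / h" using h by (simp add: field_simps)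
      have "norm (a + b) \<le> (1 + 1/h) * norm a"
        using norm_triangle_ineq[of a b] b by (simp add: algebra_simps)
      then have "norm (a + b) powr p \<le> K * norm a powr p"
        unfolding K_def using h p by (auto simp flip: powr_mult intro!: powr_mono2)
      moreover have "norm b \<le> (1 + 1/h) * norm a" using b norm_ge_zero[of a] unfolding distrib_right
        by (simp del: norm_ge_zero)
      then have "norm b powr p \<le> K * norm a powr p"
        unfolding K_def using h p by (auto simp flip: powr_mult intro!: powr_mono2)
      moreover have "0 \<le> norm (a + b) powr p" "0 \<le> norm b powr p" "0 \<le> e * norm b powr p" using e by auto
      ultimately show ?thesis by linarith
    qed
  qed
qed

section \<open>Geometry of the sequence spaces\<close>

abbreviation ell_set :: "real \<Rightarrow> (nat \<Rightarrow> 'a::real_normed_field) set" where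
  "ell_set p \<equiv> vcarrier (ell p)"

abbreviation ell_norm :: "real \<Rightarrow> (nat \<Rightarrow> 'a::real_normed_field) \<Rightarrow> real" where
  "ell_norm p \<equiv> vnorm (ell p)"

lemma ell_add [simp]: "vadd (ell p) x y = (\<lambda>n. x n + y n)"
  and ell_scale [simp]: "vscale (ell p) c x = (\<lambda>n. c * x n)"
  and mem_ell_set: "x \<in> ell_set p \<longleftrightarrow> summable (\<lambda>n. norm (x n) powr p)"
  by (simp_all add: ell_def)

lemma ell_norm_nonneg [simp]: "0 \<le> ell_norm p x"
  by (simp add: ell_def)

lemma ell_norm_powr:
  "ell_norm p x powr p = (\<Sum>n. norm (x n) powr p)" if "x \<in> ell_set p" "1 < p"
  using that suminf_nonneg[of "\<lambda>n. norm (x n) powr p"] by (simp add: ell_def powr_powr)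

lemma ell_norm_sums:
  "(\<lambda>n. norm (x n) powr p) sums (ell_norm p x powr p)" if "x \<in> ell_set p" "1 < p"
  using that by (simp add: ell_norm_powr mem_ell_set summable_sums)

lemma ell_norm_eqI:
  assumes "(\<lambda>n. norm (x n) powr p) sums (r powr p)" "0 \<le> r" "1 < p"
  shows "ell_norm p x = r"
  using powr_root[OF assms(2,3)] by (simp add: ell_def sums_unique[OF assms(1), symmetric])

lemma ell_norm_le_iff: "ell_norm p x \<le> r \<longleftrightarrow> ell_norm p x powr p \<le> r powr p" if "0 \<le> r" "1 < p"
proof
  assume "ell_norm p x powr p \<le> r powr p"
  then have "(ell_norm p x powr p) powr (1/p) \<le> (r powr p) powr (1/p)"
    using that by - (rule powr_mono2, auto)
  then show "ell_norm p x \<le> r"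
    unfolding powr_root[OF that] powr_root[OF ell_norm_nonneg that(2)] .
qed (use that in \<open>auto intro: powr_mono2\<close>)

lemma ell_zero [simp]: "(\<lambda>n. 0) \<in> ell_set p" "ell_norm p (\<lambda>n. 0) = 0"
  by (simp_all add: ell_def)

lemma ell_norm_eq_0D: "x = (\<lambda>n. 0)" if "ell_norm p x = 0" "x \<in> ell_set p" "1 < p"
proof -
  have "(\<Sum>n. norm (x n) powr p) = 0" using that ell_norm_powr[OF that(2,3)] by simp
  then have "norm (x n) powr p = 0" for n
    using that suminf_eq_zero_iff[of "\<lambda>n. norm (x n) powr p"] by (simp add: mem_ell_set)
  then show ?thesis by auto
qed

lemma ell_scale_mem [intro]: "(\<lambda>n. c * x n) \<in> ell_set p" if "x \<in> ell_set p"
  using that by (simp add: mem_ell_set norm_mult powr_mult summable_mult)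

lemma ell_norm_scale [simp]: "ell_norm p (\<lambda>n. c * x n) = norm c * ell_norm p x"
  if "x \<in> ell_set p" "1 < p"
proof (rule ell_norm_eqI)
  show "(\<lambda>n. norm (c * x n) powr p) sums (norm c * ell_norm p x) powr p"
    using sums_mult[OF ell_norm_sums[OF that], of "norm c powr p"]
    by (simp add: norm_mult powr_mult)
qed (use that in auto)

lemma ell_add_mem [intro]:
  fixes x y :: "nat \<Rightarrow> 'a::real_normed_field"
  assumes "x \<in> ell_set p" "y \<in> ell_set p" "1 < p"
  shows "(\<lambda>n. x n + y n) \<in> ell_set p"
proof -
  obtain K where K: "0 \<le> K" "\<And>a b :: 'a. \<bar>norm (a + b) powr p - norm b powr p\<bar> \<le> 1 * norm b powr p + K * norm a powr p"
    using norm_add_powr_diff_le[OF assms(3) zero_less_one] by blast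
  have "norm (x n + y n) powr p \<le> 2 * norm (y n) powr p + K * norm (x n) powr p" for n
    using K(2)[of "x n" "y n"] by linarith
  moreover have "summable (\<lambda>n. 2 * norm (y n) powr p + K * norm (x n) powr p)"
    using assms by (intro summable_add summable_mult) (auto simp: mem_ell_set)
  ultimately show ?thesis unfolding mem_ell_set
    by (auto intro: summable_comparison_test'[of _ 0])
qed

lemma ell_diff_mem [intro]:
  "(\<lambda>n. x n - y n) \<in> ell_set p" if "x \<in> ell_set p" "y \<in> ell_set p" "1 < p"
  using ell_add_mem[OF that(1) ell_scale_mem[OF that(2), of "-1"] that(3)] by simp

text \<open>
  For \<open>\<parallel>x\<parallel> = 1\<close> the map \<open>ell_pair p x\<close> is the norming functional of \<open>x\<close>.
\<close>

definition ell_pair :: "real \<Rightarrow> (nat \<Rightarrow> 'a::real_normed_field) \<Rightarrow> (nat \<Rightarrow> 'a) \<Rightarrow> 'a" where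
  "ell_pair p x z = (\<Sum>n. dual_coeff p (x n) * z n)"

text \<open>
  Young's inequality in each coordinate.
\<close>

lemma ell_pair_summable_norm:
  assumes "x \<in> ell_set p" "z \<in> ell_set p" "1 < p"
  shows "summable (\<lambda>n. norm (dual_coeff p (x n) * z n))"
    and "p * (\<Sum>n. norm (dual_coeff p (x n) * z n)) \<le> ell_norm p z powr p + (p - 1) * ell_norm p x powr p"
proof -
  let ?g = "\<lambda>n. (norm (z n) powr p + (p - 1) * norm (x n) powr p)"
  have g: "?g sums (ell_norm p z powr p + (p - 1) * ell_norm p x powr p)"
    using assms by (intro sums_add sums_mult ell_norm_sums)
  have le: "p * norm (dual_coeff p (x n) * z n) \<le> ?g n" for n
    using assms powr_young[of p "norm (z n)" "norm (x n)"] by (simp add: norm_mult norm_dual_coeff)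
  have "summable (\<lambda>n. p * norm (dual_coeff p (x n) * z n))"
    by (rule summable_comparison_test'[OF sums_summable[OF g], of 0]) (use le assms in \<open>auto simp: abs_mult\<close>)
  then show s: "summable (\<lambda>n. norm (dual_coeff p (x n) * z n))"
    using assms by simp
  have "p * (\<Sum>n. norm (dual_coeff p (x n) * z n)) = (\<Sum>n. p * norm (dual_coeff p (x n) * z n))"
    by (rule suminf_mult[OF s, symmetric])
  also have "\<dots> \<le> (\<Sum>n. ?g n)"
    using le s g by (intro suminf_le summable_mult) (auto simp: sums_iff)
  finally show "p * (\<Sum>n. norm (dual_coeff p (x n) * z n)) \<le> ell_norm p z powr p + (p - 1) * ell_norm p x powr p"
    using g by (simp add: sums_iff)
qed

lemma ell_pair_sums:
  fixes x :: "nat \<Rightarrow> 'a::{real_normed_field, banach}"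
  assumes "x \<in> ell_set p" "z \<in> ell_set p" "1 < p"
  shows "(\<lambda>n. dual_coeff p (x n) * z n) sums ell_pair p x z"
  unfolding ell_pair_def using summable_norm_cancel[OF ell_pair_summable_norm(1)[OF assms]]
  by (simp add: summable_sums)

lemma ell_pair_add:
  fixes x :: "nat \<Rightarrow> 'a::{real_normed_field, banach}"
  assumes "x \<in> ell_set p" "y \<in> ell_set p" "z \<in> ell_set p" "1 < p"
  shows "ell_pair p x (\<lambda>n. y n + z n) = ell_pair p x y + ell_pair p x z"
  unfolding ell_pair_def[of _ _ "\<lambda>n. y n + z n"] distrib_left
  by (intro sums_unique[symmetric] sums_add ell_pair_sums assms)

lemma ell_pair_scale:
  fixes x :: "nat \<Rightarrow> 'a::{real_normed_field, banach}"
  assumes "x \<in> ell_set p" "z \<in> ell_set p" "1 < p"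
  shows "ell_pair p x (\<lambda>n. c * z n) = c * ell_pair p x z"
  unfolding ell_pair_def[of _ _ "\<lambda>n. c * z n"] mult.left_commute[of _ c]
  by (intro sums_unique[symmetric] sums_mult ell_pair_sums assms)

lemma ell_pair_self:
  fixes x :: "nat \<Rightarrow> 'a::{real_normed_field, banach}"
  assumes "x \<in> ell_set p" "1 < p"
  shows "ell_pair p x x = of_real (ell_norm p x powr p)"
  unfolding ell_pair_def dual_coeff_mult_self
  by (intro sums_unique[symmetric] sums_of_real ell_norm_sums assms)

text \<open>
  Hoelder's inequality: normalizing \<open>z\<close> turns the bound from Young's inequality into \<open>1\<close>.
\<close>

lemma ell_pair_le:
  fixes x :: "nat \<Rightarrow> 'a::{real_normed_field, banach}"
  assumes "x \<in> ell_set p" "z \<in> ell_set p" "1 < p" "ell_norm p x = 1"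
  shows "norm (ell_pair p x z) \<le> ell_norm p z"
proof (cases "ell_norm p z = 0")
  case True
  then have "z = (\<lambda>n. 0)" using assms ell_norm_eq_0D by blast
  then show ?thesis using True by (simp add: ell_pair_def)
next
  case False
  define r where "r = ell_norm p z"
  have r: "r > 0" using False by (simp add: r_def less_le)
  define z' where "z' = (\<lambda>n. of_real (1/r) * z n)"
  have z': "z' \<in> ell_set p" using assms unfolding z'_def by (intro ell_scale_mem)
  have "ell_norm p z' = 1" using r unfolding z'_def ell_norm_scale[OF assms(2,3)] by (simp add: r_def norm_divide)
  then have "p * (\<Sum>n. norm (dual_coeff p (x n) * z' n)) \<le> p"
    using ell_pair_summable_norm(2)[OF assms(1) z' assms(3)] assms by simp
  then have "(\<Sum>n. norm (dual_coeff p (x n) * z' n)) \<le> 1" using assms by simp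
  then have "norm (ell_pair p x z') \<le> 1"
    using summable_norm[OF ell_pair_summable_norm(1)[OF assms(1) z' assms(3)]]
    by (simp add: ell_pair_def)
  moreover have "ell_pair p x z' = of_real (1/r) * ell_pair p x z"
    unfolding z'_def using assms by (intro ell_pair_scale)
  ultimately show ?thesis using r by (simp add: norm_mult norm_divide r_def[symmetric])
qed

text \<open>
  Minkowski's inequality: the norm of \<open>x + y\<close> is the value of its norming functional on \<open>x + y\<close>,
  which is at most \<open>\<parallel>x\<parallel> + \<parallel>y\<parallel>\<close> by Hoelder's inequality.
\<close>

lemma ell_norm_triangle:
  fixes x :: "nat \<Rightarrow> 'a::{real_normed_field, banach}"
  assumes "x \<in> ell_set p" "y \<in> ell_set p" "1 < p"
  shows "ell_norm p (\<lambda>n. x n + y n) \<le> ell_norm p x + ell_norm p y"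
proof -
  define w where "w = (\<lambda>n. x n + y n)"
  define r where "r = ell_norm p w"
  have w: "w \<in> ell_set p" unfolding w_def using assms by auto
  show ?thesis
  proof (cases "r = 0")
    case True then show ?thesis unfolding r_def w_def by simp
  next
    case False
    then have r: "r > 0" by (simp add: r_def less_le)
    define u where "u = (\<lambda>n. of_real (1/r) * w n)"
    have u: "u \<in> ell_set p" using w unfolding u_def by (intro ell_scale_mem)
    have nu: "ell_norm p u = 1" using r unfolding u_def ell_norm_scale[OF w assms(3)] by (simp add: r_def norm_divide)
    have "w = (\<lambda>n. of_real r * u n)" using r by (auto simp: u_def)
    then have "ell_pair p u w = of_real r"
      using ell_pair_scale[OF u u assms(3), of "of_real r"] ell_pair_self[OF u assms(3)] nu by simp
    moreover have "ell_pair p u w = ell_pair p u x + ell_pair p u y"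
      unfolding w_def using u assms by (intro ell_pair_add)
    ultimately have "r = norm (ell_pair p u x + ell_pair p u y)" using r by simp
    also have "\<dots> \<le> ell_norm p x + ell_norm p y"
      using ell_pair_le[OF u assms(1,3) nu] ell_pair_le[OF u assms(2,3) nu]
      by (intro norm_triangle_le) auto
    finally show ?thesis by (simp add: r_def w_def)
  qed
qed

text \<open>
  Uniform convexity in the form that is needed: a unit vector on which the norming functional of
  \<open>x\<close> is almost \<open>1\<close> is close to \<open>x\<close>. The Bregman distances of the coordinates of two unit
  vectors add up to \<open>p (1 - Re j\<^sub>x(z))\<close>.
\<close>

lemma ell_uniformly_convex:
  assumes p: "1 < p" and e: "0 < e"
  shows "\<exists>d>0. \<forall>x z :: nat \<Rightarrow> 'a::{real_normed_field, euclidean_space}.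
    x \<in> ell_set p \<longrightarrow> z \<in> ell_set p \<longrightarrow> ell_norm p x = 1 \<longrightarrow> ell_norm p z = 1 \<longrightarrow>
    1 - d \<le> re_part (ell_pair p x z) \<longrightarrow> ell_norm p (\<lambda>n. x n - z n) \<le> e"
proof -
  define e' where "e' = e powr p / 4"
  have e': "e' > 0" using e by (simp add: e'_def)
  obtain K where K: "0 \<le> K" "\<And>a c :: 'a.
      norm (a - c) powr p \<le> e' * (norm a powr p + norm c powr p) + K * bregman p a c"
    using norm_diff_powr_le_bregman[OF p e'] by blast
  define d where "d = 2 * e' / (p * (K + 1))"
  have d: "d > 0" "K * (p * d) \<le> 2 * e'"
  proof -
    show "d > 0" using e' p K unfolding d_def by (intro divide_pos_pos mult_pos_pos) auto
    have "(K + 1) * (p * d) = 2 * e'" using p K by (simp add: d_def)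
    moreover have "0 \<le> p * d" using \<open>d > 0\<close> p by simp
    ultimately show "K * (p * d) \<le> 2 * e'" unfolding distrib_right by linarith
  qed
  show ?thesis
  proof (intro exI[of _ d] conjI d(1) allI impI)
    fix x z :: "nat \<Rightarrow> 'a"
    assume x: "x \<in> ell_set p" "z \<in> ell_set p" "ell_norm p x = 1" "ell_norm p z = 1"
      and c: "1 - d \<le> re_part (ell_pair p x z)"
    have xz: "(\<lambda>n. x n - z n) \<in> ell_set p" using x p by auto
    have 1: "(\<lambda>n. norm (x n) powr p) sums 1" "(\<lambda>n. norm (z n) powr p) sums 1"
      using ell_norm_sums[of x p] ell_norm_sums[of z p] x p by auto
    have 2: "(\<lambda>n. re_part (dual_coeff p (x n) * z n)) sums re_part (ell_pair p x z)"
      using x p by (intro bounded_linear.sums[OF bounded_linear_re_part] ell_pair_sums)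
    have "(\<lambda>n. bregman p (x n) (z n)) sums (1 + (p - 1) * 1 - p * re_part (ell_pair p x z))"
      unfolding bregman_def using 1 2 by (intro sums_add sums_diff sums_mult)
    then have S: "(\<lambda>n. e' * (norm (x n) powr p + norm (z n) powr p) + K * bregman p (x n) (z n))
        sums (e' * (1 + 1) + K * (1 + (p - 1) * 1 - p * re_part (ell_pair p x z)))"
      using 1 by (intro sums_add sums_mult)
    have "ell_norm p (\<lambda>n. x n - z n) powr p \<le> e' * (1 + 1) + K * (1 + (p - 1) * 1 - p * re_part (ell_pair p x z))"
      by (rule sums_le[OF _ ell_norm_sums[OF xz p] S]) (rule K(2))
    also have "\<dots> = 2 * e' + K * (p * (1 - re_part (ell_pair p x z)))" by (simp add: algebra_simps)
    also have "K * (p * (1 - re_part (ell_pair p x z))) \<le> K * (p * d)"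
      using c p K(1) by (intro mult_left_mono) auto
    also have "2 * e' + K * (p * d) \<le> e powr p" using d by (simp add: e'_def)
    finally show "ell_norm p (\<lambda>n. x n - z n) \<le> e" using e p by (subst ell_norm_le_iff) auto
  qed
qed

text \<open>
  The scalar estimate, summed over the coordinates, bounds \<open>\<parallel>y + s z\<parallel>\<^sup>p\<close>; Bernoulli's inequality
  takes the \<open>p\<close>-th root.
\<close>

lemma ell_uniformly_smooth:
  assumes p: "1 < p" and e: "0 < e"
  shows "\<exists>s>0. \<forall>y z :: nat \<Rightarrow> 'a::{real_normed_field, euclidean_space}.
    y \<in> ell_set p \<longrightarrow> z \<in> ell_set p \<longrightarrow> ell_norm p y = 1 \<longrightarrow> ell_norm p z \<le> 1 \<longrightarrow>
    ell_norm p (\<lambda>n. y n + of_real s * z n) \<le> 1 + s * re_part (ell_pair p y z) + s * e"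
proof -
  have e2: "e / 2 > 0" using e by simp
  obtain s where s: "0 < s" "\<And>a b :: 'a. norm (a + of_real s * b) powr p
         \<le> norm a powr p + p * s * re_part (dual_coeff p a * b) + p * s * (e/2) * (norm a powr p + norm b powr p)"
    using norm_add_powr_le_linear[OF p e2] by blast
  show ?thesis
  proof (intro exI[of _ s] conjI s(1) allI impI)
    fix y z :: "nat \<Rightarrow> 'a"
    assume y: "y \<in> ell_set p" "z \<in> ell_set p" "ell_norm p y = 1" and z: "ell_norm p z \<le> 1"
    define v where "v = ell_norm p (\<lambda>n. y n + of_real s * z n)"
    have m: "(\<lambda>n. y n + of_real s * z n) \<in> ell_set p" using y p by auto
    have 1: "(\<lambda>n. norm (y n) powr p) sums 1"
      using ell_norm_sums[of y p] y p by auto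
    have 2: "(\<lambda>n. re_part (dual_coeff p (y n) * z n)) sums re_part (ell_pair p y z)"
      using y p by (intro bounded_linear.sums[OF bounded_linear_re_part] ell_pair_sums)
    have S: "(\<lambda>n. norm (y n) powr p + p * s * re_part (dual_coeff p (y n) * z n)
          + p * s * (e/2) * (norm (y n) powr p + norm (z n) powr p))
        sums (1 + p * s * re_part (ell_pair p y z) + p * s * (e/2) * (1 + ell_norm p z powr p))"
      using 1 2 y p by (intro sums_add sums_mult ell_norm_sums)
    have "v powr p \<le> 1 + p * s * re_part (ell_pair p y z) + p * s * (e/2) * (1 + ell_norm p z powr p)"
      unfolding v_def by (rule sums_le[OF _ ell_norm_sums[OF m p] S]) (rule s(2))
    also have "\<dots> \<le> 1 + p * s * re_part (ell_pair p y z) + p * s * (e/2) * (1 + 1)"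
      using z s p e powr_mono2[of p "ell_norm p z" 1] by (intro add_left_mono mult_left_mono) auto
    finally have "p * (v - 1) \<le> p * (s * re_part (ell_pair p y z) + s * e)"
      using powr_bernoulli[OF p, of v] by (simp add: v_def algebra_simps)
    then have "v - 1 \<le> s * re_part (ell_pair p y z) + s * e" using p by simp
    then show "ell_norm p (\<lambda>n. y n + of_real s * z n) \<le> 1 + s * re_part (ell_pair p y z) + s * e"
      by (simp add: v_def)
  qed
qed

text \<open>
  On finitely many coordinates the splitting holds by continuity, as \<open>w k\<close> tends to zero there.
  On the remaining ones \<open>x\<close> is small, and the scalar inequality bounds the error by a small
  multiple of \<open>\<parallel>w k\<parallel>\<^sup>p\<close> plus a multiple of the tail of \<open>\<parallel>x\<parallel>\<^sup>p\<close>.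
\<close>

lemma ell_brezis_lieb:
  fixes x :: "nat \<Rightarrow> 'a::real_normed_field"
  assumes p: "1 < p" and x: "x \<in> ell_set p" and w: "\<And>k. w k \<in> ell_set p" "\<And>k. ell_norm p (w k) \<le> W"
    and w0: "\<And>n. (\<lambda>k. w k n) \<longlonglongrightarrow> 0"
  shows "(\<lambda>k. ell_norm p (\<lambda>n. x n + w k n) powr p - ell_norm p (w k) powr p) \<longlonglongrightarrow> ell_norm p x powr p"
proof (rule LIMSEQ_I)
  fix r :: real assume r: "0 < r"
  have W: "0 \<le> W" using w(2)[of 0] ell_norm_nonneg[of p "w 0"] by linarith
  define e where "e = r / (4 * (W powr p + 1))"
  have e: "e > 0" "e * W powr p \<le> r / 4"
  proof -
    have W': "0 < W powr p + 1" using powr_ge_zero[of W p] by linarith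
    then show "e > 0" using r unfolding e_def by simp
    have "e * W powr p \<le> e * (W powr p + 1)" using \<open>e > 0\<close> by (intro mult_left_mono) auto
    also have "\<dots> = r / 4" using W' by (simp add: e_def field_simps)
    finally show "e * W powr p \<le> r / 4" .
  qed
  obtain K where K: "0 \<le> K" "\<And>a b :: 'a.
       \<bar>norm (a + b) powr p - norm b powr p\<bar> \<le> e * norm b powr p + K * norm a powr p"
    using norm_add_powr_diff_le[OF p e(1)] by blast
  define f where "f k n = norm (x n + w k n) powr p - norm (w k n) powr p - norm (x n) powr p" for k n
  have fs: "f k sums (ell_norm p (\<lambda>n. x n + w k n) powr p - ell_norm p (w k) powr p - ell_norm p x powr p)" for k
    unfolding f_def using x w p by (intro sums_diff ell_norm_sums) auto
  have fle: "\<bar>f k n\<bar> \<le> e * norm (w k n) powr p + (K + 1) * norm (x n) powr p" for k n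
    using K(2)[of "x n" "w k n"] unfolding f_def distrib_right
    by (smt (verit) powr_ge_zero)
  have sx: "summable (\<lambda>n. (K + 1) * norm (x n) powr p)" using x by (auto simp: mem_ell_set)
  obtain N where N: "norm (\<Sum>n. (K + 1) * norm (x (n + N)) powr p) < r / 4"
    using suminf_exist_split[OF _ sx, of "r/4"] r by auto
  have "(\<lambda>k. \<Sum>n<N. f k n) \<longlonglongrightarrow> (\<Sum>n<N. norm (x n + 0) powr p - norm (0::'a) powr p - norm (x n) powr p)"
    unfolding f_def using p by (intro tendsto_intros tendsto_powr' w0) auto
  then have "(\<lambda>k. \<Sum>n<N. f k n) \<longlonglongrightarrow> 0" by simp
  then obtain k0 where k0: "\<And>k. k \<ge> k0 \<Longrightarrow> norm ((\<Sum>n<N. f k n) - 0) < r / 4"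
    using LIMSEQ_D[of _ 0 "r/4"] r by (metis zero_less_divide_iff zero_less_numeral)
  show "\<exists>no. \<forall>k\<ge>no. norm (ell_norm p (\<lambda>n. x n + w k n) powr p - ell_norm p (w k) powr p - ell_norm p x powr p) < r"
  proof (intro exI allI impI)
    fix k assume k: "k0 \<le> k"
    define g where "g n = e * norm (w k n) powr p + (K + 1) * norm (x n) powr p" for n
    have sw: "summable (\<lambda>n. e * norm (w k n) powr p)" using w by (auto simp: mem_ell_set)
    have sw': "summable (\<lambda>n. e * norm (w k (n + N)) powr p)" and sx': "summable (\<lambda>n. (K + 1) * norm (x (n + N)) powr p)"
      using summable_ignore_initial_segment[OF sw] summable_ignore_initial_segment[OF sx] by auto
    have "(\<Sum>n. e * norm (w k (n + N)) powr p) \<le> (\<Sum>n. e * norm (w k n) powr p)"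
      using suminf_split_initial_segment[OF sw, of N] e by (simp add: sum_nonneg)
    also have "\<dots> = e * ell_norm p (w k) powr p"
      using w p by (simp add: ell_norm_powr suminf_mult mem_ell_set)
    also have "\<dots> \<le> e * W powr p" using e w p by (intro mult_left_mono powr_mono2) auto
    finally have tw: "(\<Sum>n. e * norm (w k (n + N)) powr p) \<le> r / 4" using e by simp
    have "summable (\<lambda>n. g (n + N))" unfolding g_def using sw' sx' by (rule summable_add)
    have fg: "norm (f k (n + N)) \<le> g (n + N)" for n unfolding g_def using fle by simp
    have "norm (\<Sum>n. f k (n + N)) \<le> (\<Sum>n. g (n + N))"
      by (rule norm_suminf_le[OF fg]) fact
    also have "\<dots> = (\<Sum>n. e * norm (w k (n + N)) powr p) + (\<Sum>n. (K + 1) * norm (x (n + N)) powr p)"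
      unfolding g_def by (intro suminf_add[symmetric] sw' sx')
    finally have t: "norm (\<Sum>n. f k (n + N)) < r / 2" using tw N by simp
    have "(\<Sum>n. f k n) = (\<Sum>n. f k (n + N)) + (\<Sum>n<N. f k n)"
      using fs by (intro suminf_split_initial_segment) (auto simp: sums_iff)
    then have "norm (\<Sum>n. f k n) < r" using t k0[OF k] r by simp
    then show "norm (ell_norm p (\<lambda>n. x n + w k n) powr p - ell_norm p (w k) powr p - ell_norm p x powr p) < r"
      using fs[of k] by (simp add: sums_iff)
  qed
qed

text \<open>
  Closed balls are closed under coordinatewise convergence, because the finite partial sums of
  the norm are continuous in the coordinates.
\<close>

lemma ell_pointwise_limit:
  fixes x :: "nat \<Rightarrow> 'a::real_normed_field"
  assumes p: "1 < p" and u: "\<And>k. u k \<in> ell_set p" "\<And>k. ell_norm p (u k) \<le> W"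
    and ux: "\<And>n. (\<lambda>k. u k n) \<longlonglongrightarrow> x n"
  shows "x \<in> ell_set p" "ell_norm p x \<le> W"
proof -
  have W: "0 \<le> W" using u(2)[of 0] ell_norm_nonneg[of p "u 0"] by linarith
  have le: "(\<Sum>n<N. norm (x n) powr p) \<le> W powr p" for N
  proof (rule LIMSEQ_le_const2)
    show "(\<lambda>k. \<Sum>n<N. norm (u k n) powr p) \<longlonglongrightarrow> (\<Sum>n<N. norm (x n) powr p)"
      using p by (intro tendsto_intros tendsto_powr' ux) auto
    have "(\<Sum>n<N. norm (u k n) powr p) \<le> W powr p" for k
    proof -
      have "(\<Sum>n<N. norm (u k n) powr p) \<le> (\<Sum>n. norm (u k n) powr p)"
        using u by (intro sum_le_suminf) (auto simp: mem_ell_set)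
      also have "\<dots> = ell_norm p (u k) powr p" using u p by (simp add: ell_norm_powr)
      also have "\<dots> \<le> W powr p" using u p by (intro powr_mono2) auto
      finally show ?thesis .
    qed
    then show "\<exists>N'. \<forall>n\<ge>N'. (\<Sum>m<N. norm (u n m) powr p) \<le> W powr p" by auto
  qed
  have s: "summable (\<lambda>n. norm (x n) powr p)"
    by (rule summableI_nonneg_bounded[OF _ le]) auto
  then show x: "x \<in> ell_set p" by (simp add: mem_ell_set)
  have "(\<Sum>n. norm (x n) powr p) \<le> W powr p" by (intro suminf_le_const s le)
  then show "ell_norm p x \<le> W" using x p W by (subst ell_norm_le_iff) (auto simp: ell_norm_powr)
qed

lemma ell_norm_coord: "norm (x n) \<le> ell_norm p x" if "x \<in> ell_set p" "1 < p"
proof -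
  have "(\<Sum>i\<in>{n}. norm (x i) powr p) \<le> (\<Sum>i. norm (x i) powr p)"
    using that by (intro sum_le_suminf) (auto simp: mem_ell_set)
  then have "(norm (x n) powr p) powr (1/p) \<le> (ell_norm p x powr p) powr (1/p)"
    using that by - (rule powr_mono2, auto simp: ell_norm_powr)
  then show ?thesis
    unfolding powr_root[OF norm_ge_zero that(2)] powr_root[OF ell_norm_nonneg that(2)] .
qed

text \<open>
  Tychonoff's theorem. With a countable index set it gives weak sequential compactness of balls
  of \<open>\<ell>\<^sub>p\<close>; with operators as indices it gives cluster points of functionals.
\<close>

lemma compact_pointwise_bounded:
  fixes B :: "'i \<Rightarrow> real"
  shows "compact {f :: 'i \<Rightarrow> 'b::euclidean_space. \<forall>i. norm (f i) \<le> B i}"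
proof -
  have "compactin (product_topology (\<lambda>i::'i. euclidean) UNIV) (PiE UNIV (\<lambda>i. cball (0::'b) (B i)))"
    by (subst compactin_PiE) auto
  moreover have "PiE UNIV (\<lambda>i. cball (0::'b) (B i)) = {f. \<forall>i. norm (f i) \<le> B i}"
    by (auto simp: PiE_UNIV_domain)
  ultimately show ?thesis by (simp add: euclidean_product_topology)
qed

lemma ell_pointwise_convergent_subseq:
  fixes u :: "nat \<Rightarrow> nat \<Rightarrow> 'a::{real_normed_field, euclidean_space}"
  assumes p: "1 < p" and u: "\<And>k. u k \<in> ell_set p" "\<And>k. ell_norm p (u k) \<le> W"
  obtains x r where "strict_mono (r :: nat \<Rightarrow> nat)" "x \<in> ell_set p" "ell_norm p x \<le> W"
    "\<And>n. (\<lambda>k. u (r k) n) \<longlonglongrightarrow> x n"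
proof -
  have "seq_compact {f :: nat \<Rightarrow> 'a. \<forall>i. norm (f i) \<le> W}"
    using compact_pointwise_bounded[of "\<lambda>_. W"] by (rule compact_imp_seq_compact)
  moreover have "u k \<in> {f :: nat \<Rightarrow> 'a. \<forall>i. norm (f i) \<le> W}" for k
    using ell_norm_coord[OF u(1) p] u(2) by (auto intro: order_trans)
  ultimately obtain x r where r: "strict_mono (r :: nat \<Rightarrow> nat)" "(u \<circ> r) \<longlonglongrightarrow> x"
    unfolding seq_compact_def by blast
  have lim: "(\<lambda>k. u (r k) n) \<longlonglongrightarrow> x n" for n
    using continuous_on_tendsto_compose[OF continuous_on_product_coordinates r(2)]
    by (simp add: o_def)
  have "x \<in> ell_set p" "ell_norm p x \<le> W"
    using ell_pointwise_limit[OF p, of "\<lambda>k. u (r k)" W x] u lim by auto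
  with r lim that show ?thesis by blast
qed

section \<open>Operators between seminormed spaces\<close>

text \<open>
  Just enough structure to make spaces of bounded operators seminormed spaces again. The law
  \<open>add_add\<close> is what associativity and commutativity contribute to the additivity of a sum of
  operators; \<open>scale_scale\<close> plays the same role for multiples.
\<close>

locale seminormed_nspace =
  fixes X :: "('a::real_normed_field, 'v) nspace"
  assumes nonempty: "vcarrier X \<noteq> {}"
    and add_closed: "\<lbrakk>x \<in> vcarrier X; y \<in> vcarrier X\<rbrakk> \<Longrightarrow> vadd X x y \<in> vcarrier X"
    and scale_closed: "x \<in> vcarrier X \<Longrightarrow> vscale X c x \<in> vcarrier X"
    and add_add: "\<lbrakk>x \<in> vcarrier X; y \<in> vcarrier X; x' \<in> vcarrier X; y' \<in> vcarrier X\<rbrakk>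
      \<Longrightarrow> vadd X (vadd X x y) (vadd X x' y') = vadd X (vadd X x x') (vadd X y y')"
    and scale_add: "\<lbrakk>x \<in> vcarrier X; y \<in> vcarrier X\<rbrakk>
      \<Longrightarrow> vscale X c (vadd X x y) = vadd X (vscale X c x) (vscale X c y)"
    and scale_scale: "x \<in> vcarrier X \<Longrightarrow> vscale X c (vscale X d x) = vscale X d (vscale X c x)"
    and norm_nonneg: "x \<in> vcarrier X \<Longrightarrow> 0 \<le> vnorm X x"
    and norm_scale: "x \<in> vcarrier X \<Longrightarrow> vnorm X (vscale X c x) = norm c * vnorm X x"
    and norm_triangle: "\<lbrakk>x \<in> vcarrier X; y \<in> vcarrier X\<rbrakk> \<Longrightarrow> vnorm X (vadd X x y) \<le> vnorm X x + vnorm X y"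
begin

lemma unit_ball_nonempty: "unit_ball X \<noteq> {}"
proof -
  obtain x where x: "x \<in> vcarrier X" using nonempty by blast
  then have "vscale X 0 x \<in> unit_ball X" by (simp add: unit_ball_def scale_closed norm_scale)
  then show ?thesis by blast
qed

end

lemma seminormed_ell:
  "seminormed_nspace (ell p :: ('a::{real_normed_field, banach}, nat \<Rightarrow> 'a) nspace)" if "1 < p"
  using that
  by unfold_locales
    (auto intro: ell_norm_triangle exI[of _ "\<lambda>n. 0"] simp: algebra_simps simp flip: ex_in_conv)

lemma seminormed_scalar: "seminormed_nspace scalar_space"
  by unfold_locales (auto simp: scalar_space_def algebra_simps norm_mult norm_triangle_ineq)

locale seminormed_pair = X: seminormed_nspace X + Y: seminormed_nspace Y
  for X :: "('a::real_normed_field, 'v) nspace" and Y :: "('a, 'w) nspace"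
begin

lemma op_closed: "T x \<in> vcarrier Y" if "T \<in> bounded_ops X Y" "x \<in> vcarrier X"
  using that by (auto simp: bounded_ops_def)

lemma op_add: "T (vadd X x y) = vadd Y (T x) (T y)"
  if "T \<in> bounded_ops X Y" "x \<in> vcarrier X" "y \<in> vcarrier X"
  using that by (auto simp: bounded_ops_def)

lemma op_scale: "T (vscale X c x) = vscale Y c (T x)"
  if "T \<in> bounded_ops X Y" "x \<in> vcarrier X"
  using that by (auto simp: bounded_ops_def)

lemma op_bdd_above: "bdd_above ((\<lambda>x. vnorm Y (T x)) ` unit_ball X)" if T: "T \<in> bounded_ops X Y"
proof -
  obtain K where K: "\<And>x. x \<in> vcarrier X \<Longrightarrow> vnorm Y (T x) \<le> K * vnorm X x"
    using T unfolding bounded_ops_def by blast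
  have "vnorm Y (T x) \<le> \<bar>K\<bar>" if "x \<in> unit_ball X" for x
  proof -
    have x: "x \<in> vcarrier X" "vnorm X x \<le> 1" using that by (auto simp: unit_ball_def)
    have "vnorm Y (T x) \<le> K * vnorm X x" using K x by simp
    also have "\<dots> \<le> \<bar>K\<bar> * vnorm X x" using X.norm_nonneg[OF x(1)] by (intro mult_right_mono) auto
    also have "\<dots> \<le> \<bar>K\<bar>" using x(2) by (simp add: mult_left_le)
    finally show ?thesis .
  qed
  then show ?thesis by (intro bdd_aboveI2)
qed

lemma op_norm_leI: "vnorm (op_space X Y) T \<le> c"
  if "\<And>x. x \<in> unit_ball X \<Longrightarrow> vnorm Y (T x) \<le> c"
  using that X.unit_ball_nonempty by (auto simp: op_space_def intro: cSUP_least)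

lemma op_norm_ge: "vnorm Y (T x) \<le> vnorm (op_space X Y) T"
  if "T \<in> bounded_ops X Y" "x \<in> unit_ball X"
  using cSUP_upper[OF that(2) op_bdd_above[OF that(1)]] by (simp add: op_space_def)

lemma op_norm_approx:
  assumes "c < vnorm (op_space X Y) T"
  obtains x where "x \<in> unit_ball X" "c < vnorm Y (T x)"
  using op_norm_leI[of T c] assms by (meson not_le)

lemma op_norm_nonneg: "0 \<le> vnorm (op_space X Y) T" if "T \<in> bounded_ops X Y"
proof -
  obtain x where x: "x \<in> unit_ball X" using X.unit_ball_nonempty by blast
  then have "0 \<le> vnorm Y (T x)" using op_closed[OF that] by (auto simp: unit_ball_def intro: Y.norm_nonneg)
  then show ?thesis using op_norm_ge[OF that x] by linarith
qed

lemma op_norm_bound: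
  assumes T: "T \<in> bounded_ops X Y" and x: "x \<in> vcarrier X"
  shows "vnorm Y (T x) \<le> vnorm (op_space X Y) T * vnorm X x"
proof (cases "vnorm X x = 0")
  case True
  obtain K where "vnorm Y (T x) \<le> K * vnorm X x"
    using T x by (auto simp: bounded_ops_def)
  then show ?thesis using True by simp
next
  case False
  define r where "r = vnorm X x"
  have r: "r > 0" using False X.norm_nonneg[OF x] by (simp add: r_def)
  have "vscale X (of_real (1/r)) x \<in> unit_ball X"
    using r x by (simp add: unit_ball_def X.scale_closed X.norm_scale norm_divide r_def[symmetric])
  from op_norm_ge[OF T this] have "(1/r) * vnorm Y (T x) \<le> vnorm (op_space X Y) T"
    using r by (simp add: op_scale[OF T x] Y.norm_scale[OF op_closed[OF T x]] norm_divide)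
  then show ?thesis using r by (simp add: r_def[symmetric] field_simps)
qed

lemma op_norm_approx_sphere:
  assumes T: "T \<in> bounded_ops X Y" and c: "0 \<le> c" "c < vnorm (op_space X Y) T"
  obtains x where "x \<in> unit_sphere X" "c < vnorm Y (T x)"
proof -
  obtain x where x: "x \<in> unit_ball X" "c < vnorm Y (T x)" using op_norm_approx c(2) by blast
  define r where "r = vnorm X x"
  have xc: "x \<in> vcarrier X" and r1: "r \<le> 1" using x(1) by (auto simp: unit_ball_def r_def)
  have "r \<noteq> 0" using op_norm_bound[OF T xc] x(2) c(1) by (auto simp: r_def)
  then have r: "0 < r" using X.norm_nonneg[OF xc] by (simp add: r_def)
  have "c < vnorm Y (T x)" by fact
  also have "\<dots> \<le> vnorm Y (T x) / r"
    using r r1 Y.norm_nonneg[OF op_closed[OF T xc]] by (simp add: pos_le_divide_eq mult_left_le)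
  also have "\<dots> = vnorm Y (T (vscale X (of_real (1/r)) x))"
    using r unfolding op_scale[OF T xc] Y.norm_scale[OF op_closed[OF T xc]] by (simp add: norm_divide)
  finally have "c < vnorm Y (T (vscale X (of_real (1/r)) x))" .
  moreover have "vscale X (of_real (1/r)) x \<in> unit_sphere X"
    using r xc by (simp add: unit_sphere_def X.scale_closed X.norm_scale norm_divide r_def[symmetric])
  ultimately show ?thesis using that by blast
qed

lemma op_add_closed:
  assumes S: "S \<in> bounded_ops X Y" and T: "T \<in> bounded_ops X Y"
  shows "vadd (op_space X Y) S T \<in> bounded_ops X Y"
proof -
  have "vnorm Y (vadd Y (S x) (T x)) \<le> (vnorm (op_space X Y) S + vnorm (op_space X Y) T) * vnorm X x"
    if x: "x \<in> vcarrier X" for x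
    using Y.norm_triangle[OF op_closed[OF S x] op_closed[OF T x]] op_norm_bound[OF S x] op_norm_bound[OF T x]
    by (simp add: distrib_right)
  then have "\<exists>K. \<forall>x\<in>vcarrier X. vnorm Y (vadd Y (S x) (T x)) \<le> K * vnorm X x" by blast
  then show ?thesis
    by (auto simp: op_space_def bounded_ops_def[of X Y] PiE_def X.add_closed X.scale_closed
        op_add[OF S] op_add[OF T] op_scale[OF S] op_scale[OF T] op_closed[OF S] op_closed[OF T]
        Y.add_closed Y.add_add Y.scale_add)
qed

lemma op_scale_closed:
  assumes T: "T \<in> bounded_ops X Y"
  shows "vscale (op_space X Y) c T \<in> bounded_ops X Y"
proof -
  have "vnorm Y (vscale Y c (T x)) \<le> (norm c * vnorm (op_space X Y) T) * vnorm X x"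
    if x: "x \<in> vcarrier X" for x
    using op_norm_bound[OF T x] by (simp add: Y.norm_scale op_closed[OF T x] mult.assoc mult_left_mono)
  then have "\<exists>K. \<forall>x\<in>vcarrier X. vnorm Y (vscale Y c (T x)) \<le> K * vnorm X x" by blast
  then show ?thesis
    by (auto simp: op_space_def bounded_ops_def[of X Y] PiE_def X.add_closed X.scale_closed
        op_add[OF T] op_scale[OF T] op_closed[OF T] Y.scale_closed Y.scale_add Y.scale_scale)
qed

lemma op_norm_scale:
  assumes T: "T \<in> bounded_ops X Y"
  shows "vnorm (op_space X Y) (vscale (op_space X Y) c T) = norm c * vnorm (op_space X Y) T"
proof -
  have ev: "vnorm Y (vscale (op_space X Y) c T x) = norm c * vnorm Y (T x)" if "x \<in> unit_ball X" for x
    using that T by (simp add: op_space_def unit_ball_def Y.norm_scale op_closed)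
  show ?thesis
  proof (rule antisym)
    show "vnorm (op_space X Y) (vscale (op_space X Y) c T) \<le> norm c * vnorm (op_space X Y) T"
      using op_norm_ge[OF T] by (intro op_norm_leI) (simp add: ev mult_left_mono)
    show "norm c * vnorm (op_space X Y) T \<le> vnorm (op_space X Y) (vscale (op_space X Y) c T)"
    proof (cases "c = 0")
      case True
      then show ?thesis using op_norm_nonneg[OF op_scale_closed[OF T]] by simp
    next
      case False
      have "vnorm (op_space X Y) T \<le> vnorm (op_space X Y) (vscale (op_space X Y) c T) / norm c"
      proof (rule op_norm_leI)
        fix x assume x: "x \<in> unit_ball X"
        show "vnorm Y (T x) \<le> vnorm (op_space X Y) (vscale (op_space X Y) c T) / norm c"
          using op_norm_ge[OF op_scale_closed[OF T, of c] x] False by (simp add: ev[OF x] field_simps)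
      qed
      then show ?thesis using False by (simp add: field_simps)
    qed
  qed
qed

lemma op_norm_triangle:
  assumes S: "S \<in> bounded_ops X Y" and T: "T \<in> bounded_ops X Y"
  shows "vnorm (op_space X Y) (vadd (op_space X Y) S T) \<le> vnorm (op_space X Y) S + vnorm (op_space X Y) T"
proof (rule op_norm_leI)
  fix x assume x: "x \<in> unit_ball X"
  then have c: "x \<in> vcarrier X" by (simp add: unit_ball_def)
  then show "vnorm Y (vadd (op_space X Y) S T x) \<le> vnorm (op_space X Y) S + vnorm (op_space X Y) T"
    using Y.norm_triangle[OF op_closed[OF S c] op_closed[OF T c]] op_norm_ge[OF S x] op_norm_ge[OF T x]
    by (simp add: op_space_def)
qed

lemma seminormed_op_space:
  assumes "bounded_ops X Y \<noteq> {}"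
  shows "seminormed_nspace (op_space X Y)"
proof
  have C: "vcarrier (op_space X Y) = bounded_ops X Y" by (simp add: op_space_def)
  note C' = C[symmetric]
  show "vcarrier (op_space X Y) \<noteq> {}" using assms C by simp
  fix S T S' T' c d
  { assume "S \<in> vcarrier (op_space X Y)"
    then have S: "S \<in> bounded_ops X Y" by (simp add: C)
    show "vscale (op_space X Y) c S \<in> vcarrier (op_space X Y)" using op_scale_closed[OF S] by (simp add: C)
    show "0 \<le> vnorm (op_space X Y) S" using op_norm_nonneg[OF S] .
    show "vnorm (op_space X Y) (vscale (op_space X Y) c S) = norm c * vnorm (op_space X Y) S"
      using op_norm_scale[OF S] .
    show "vscale (op_space X Y) c (vscale (op_space X Y) d S) = vscale (op_space X Y) d (vscale (op_space X Y) c S)"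
      by (auto simp: op_space_def Y.scale_scale op_closed[OF S] fun_eq_iff restrict_def)
    assume "T \<in> vcarrier (op_space X Y)"
    then have T: "T \<in> bounded_ops X Y" by (simp add: C)
    show "vadd (op_space X Y) S T \<in> vcarrier (op_space X Y)" using op_add_closed[OF S T] by (simp add: C)
    show "vnorm (op_space X Y) (vadd (op_space X Y) S T) \<le> vnorm (op_space X Y) S + vnorm (op_space X Y) T"
      using op_norm_triangle[OF S T] .
    show "vscale (op_space X Y) c (vadd (op_space X Y) S T)
      = vadd (op_space X Y) (vscale (op_space X Y) c S) (vscale (op_space X Y) c T)"
      by (auto simp: op_space_def Y.scale_add op_closed[OF S] op_closed[OF T] fun_eq_iff restrict_def)
    assume "S' \<in> vcarrier (op_space X Y)" "T' \<in> vcarrier (op_space X Y)"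
    then have S': "S' \<in> bounded_ops X Y" and T': "T' \<in> bounded_ops X Y" by (simp_all add: C)
    show "vadd (op_space X Y) (vadd (op_space X Y) S T) (vadd (op_space X Y) S' T')
       = vadd (op_space X Y) (vadd (op_space X Y) S S') (vadd (op_space X Y) T T')"
      by (auto simp: op_space_def Y.add_add op_closed[OF S] op_closed[OF T] op_closed[OF S'] op_closed[OF T']
          fun_eq_iff restrict_def)
  }
qed

end

section \<open>Coordinatewise null sequences and weak limits\<close>

lemma seminormed_pair_ell:
  "seminormed_pair (ell p :: ('a::{real_normed_field, banach}, nat \<Rightarrow> 'a) nspace) (ell q)"
  if "1 < p" "1 < q"
  using that by (intro seminormed_pair.intro seminormed_ell)

text \<open>
  The mechanism of Pitt's theorem. Let \<open>\<kappa>\<close> be the supremum of \<open>G\<close> on the unit ball and \<open>x\<close> a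
  point where it is almost attained. The perturbation \<open>x + t w\<^sub>k\<close> has norm at most
  \<open>(1 + O(t\<^sup>p))\<^bsup>1/p\<^esup>\<close> in the limit by the Brezis-Lieb splitting, whereas \<open>G\<close> gains
  \<open>t\<^sup>r G(w\<^sub>k)\<^sup>r\<close> in its \<open>r\<close>-th power. As \<open>r < p\<close>, the gain beats the cost for small \<open>t\<close> unless
  \<open>G(w\<^sub>k)\<close> tends to zero.
\<close>

lemma pitt_vanishing_on_null_seq:
  fixes G :: "(nat \<Rightarrow> 'a::{real_normed_field, banach}) \<Rightarrow> real"
  assumes r: "1 \<le> r" "r < p"
    and hom: "\<And>s x. \<lbrakk>0 \<le> s; x \<in> ell_set p\<rbrakk> \<Longrightarrow> G (\<lambda>n. of_real s * x n) = s * G x"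
    and bd: "\<And>x. x \<in> ell_set p \<Longrightarrow> G x \<le> K * ell_norm p x"
    and w: "\<And>k. w k \<in> ell_set p" "\<And>k. ell_norm p (w k) \<le> W" "\<And>n. (\<lambda>k. w k n) \<longlonglongrightarrow> 0"
    and pos: "\<And>k. 0 \<le> G (w k)"
    and split: "\<And>x t e. \<lbrakk>x \<in> ell_set p; 0 \<le> G x; 0 < t; 0 < e\<rbrakk> \<Longrightarrow>
      eventually (\<lambda>k. 0 \<le> G (\<lambda>n. x n + of_real t * w k n) \<and>
        t powr r * G (w k) powr r + G x powr r \<le> G (\<lambda>n. x n + of_real t * w k n) powr r + e) sequentially"
  shows "(\<lambda>k. G (w k)) \<longlonglongrightarrow> 0"
proof -
  have p: "1 < p" using r by simp
  have W: "0 \<le> W" using w(2)[of 0] ell_norm_nonneg[of p "w 0"] by linarith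
  define B :: "(nat \<Rightarrow> 'a) set" where "B = {x \<in> ell_set p. ell_norm p x \<le> 1}"
  have G0: "G (\<lambda>n. 0) = 0" using hom[of 0 "\<lambda>n. 0"] by simp
  have B0: "(\<lambda>n. 0) \<in> B" by (simp add: B_def)
  have "G x \<le> \<bar>K\<bar>" if "x \<in> B" for x
  proof -
    have "G x \<le> K * ell_norm p x" using bd that by (simp add: B_def)
    also have "\<dots> \<le> \<bar>K\<bar> * ell_norm p x" by (intro mult_right_mono) auto
    also have "\<dots> \<le> \<bar>K\<bar>" using that by (simp add: B_def mult_left_le)
    finally show ?thesis .
  qed
  then have bdd: "bdd_above (G ` B)" by (intro bdd_aboveI2)
  define \<kappa> where "\<kappa> = (SUP x\<in>B. G x)"
  have \<kappa>: "0 \<le> \<kappa>" using cSUP_upper[OF B0 bdd] G0 by (simp add: \<kappa>_def)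
  have G\<kappa>: "G x \<le> \<kappa> * ell_norm p x" if x: "x \<in> ell_set p" for x :: "nat \<Rightarrow> 'a"
  proof (cases "ell_norm p x = 0")
    case True then show ?thesis using bd[OF x] by simp
  next
    case False
    define s where "s = ell_norm p x"
    have s: "s > 0" using False by (simp add: s_def less_le)
    have "(\<lambda>n. of_real (1/s) * x n) \<in> B"
      unfolding B_def mem_Collect_eq ell_norm_scale[OF x p] using s
      by (intro conjI ell_scale_mem[OF x]) (simp add: norm_divide s_def[symmetric])
    from cSUP_upper[OF this bdd] have "(1/s) * G x \<le> \<kappa>"
      using hom[of "1/s", OF _ x] s unfolding \<kappa>_def by simp
    then show ?thesis using s by (simp add: s_def[symmetric] field_simps)
  qed
  define A where "A = \<kappa> powr r"
  have A: "0 \<le> A" by (simp add: A_def)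
  show ?thesis
  proof (rule order_tendstoI)
    fix a :: real assume "a < 0" then show "eventually (\<lambda>k. a < G (w k)) sequentially"
      using pos by (auto intro!: always_eventually intro: less_le_trans)
  next
    fix e :: real assume e: "0 < e"
    define E where "E = e powr r"
    have E: "E > 0" using e by (simp add: E_def)
    define V where "V = W powr p"
    have V: "V \<ge> 0" by (simp add: V_def)
    \<comment> \<open>Chosen so that the cost A V t^p is less than half of the gain E t^r.\<close>
    define t where "t = (E / (2 * (A * V + 1))) powr (1 / (p - r))"
    have AV: "0 \<le> A * V" using A V by simp
    have t: "t > 0" unfolding t_def using E AV by simp
    have tpr: "t powr (p - r) = E / (2 * (A * V + 1))"
      unfolding t_def using E AV r by (simp add: powr_powr)
    have "A * V * t powr (p - r) = (E / 2) * (A * V / (A * V + 1))"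
      using AV by (simp add: tpr)
    also have "\<dots> < (E / 2) * 1" using AV E by (intro mult_strict_left_mono) (simp_all add: divide_simps)
    finally have t1: "A * V * t powr (p - r) < E / 2" by simp
    \<comment> \<open>The tolerance for all the errors; together they use up the other half of E t^r.\<close>
    define h where "h = E * t powr r / (2 * (A + 2))"
    have h: "h > 0" using E A t by (simp add: h_def)
    have "(A + 2) * h = E * t powr r / 2" unfolding h_def using A by (simp add: field_simps)
    then have h2: "A * h + 2 * h = E * t powr r / 2" by (simp add: distrib_right)
    have "\<exists>x\<in>B. 0 \<le> G x \<and> A - h \<le> G x powr r"
    proof (cases "A \<le> h")
      case True
      then show ?thesis using G0 B0 r by (intro bexI[of _ "\<lambda>n. 0"]) auto
    next
      case False
      define \<kappa>' where "\<kappa>' = (A - h) powr (1 / r)"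
      have r': "\<kappa>' powr r = A - h" unfolding \<kappa>'_def using False r by (simp add: powr_powr)
      have "\<kappa>' < \<kappa>"
      proof (rule ccontr)
        assume "\<not> \<kappa>' < \<kappa>"
        then have "A \<le> \<kappa>' powr r" unfolding A_def using \<kappa> r by (intro powr_mono2) auto
        then show False using r' h by simp
      qed
      then obtain x where x: "x \<in> B" "\<kappa>' < G x"
        using less_cSUP_iff[of B G \<kappa>'] B0 bdd unfolding \<kappa>_def by auto
      have "0 \<le> \<kappa>'" by (simp add: \<kappa>'_def)
      then have "\<kappa>' powr r \<le> G x powr r" using x r by (intro powr_mono2) auto
      then show ?thesis using x r' \<open>0 \<le> \<kappa>'\<close> by (intro bexI[of _ x]) auto
    qed
    then obtain x where x: "x \<in> ell_set p" "ell_norm p x \<le> 1" "0 \<le> G x" "A - h \<le> G x powr r"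
      by (auto simp: B_def)
    define v where "v k = (\<lambda>n. of_real t * w k n)" for k
    have v: "v k \<in> ell_set p" for k unfolding v_def by (intro ell_scale_mem w)
    have vn: "ell_norm p (v k) = t * ell_norm p (w k)" for k
      unfolding v_def ell_norm_scale[OF w(1) p] using t by simp
    have vt: "ell_norm p (v k) \<le> t * W" for k unfolding vn using w(2) t by simp
    have v0: "(\<lambda>k. v k n) \<longlonglongrightarrow> 0" for n unfolding v_def by (rule tendsto_mult_right_zero[OF w(3)])
    have nx: "ell_norm p x powr p \<le> 1" using x p powr_mono2[of p "ell_norm p x" 1] by simp
    have "eventually (\<lambda>k. ell_norm p (\<lambda>n. x n + v k n) powr p - ell_norm p (v k) powr p < 1 + h) sequentially"
      using nx h by (intro order_tendstoD(2)[OF ell_brezis_lieb[OF p x(1) v vt v0]]) auto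
    moreover have "eventually (\<lambda>k. 0 \<le> G (\<lambda>n. x n + v k n) \<and>
        t powr r * G (w k) powr r + G x powr r \<le> G (\<lambda>n. x n + v k n) powr r + h) sequentially"
      unfolding v_def using x t h by (intro split)
    ultimately show "eventually (\<lambda>k. G (w k) < e) sequentially"
    proof eventually_elim
      case (elim k)
      have m: "(\<lambda>n. x n + v k n) \<in> ell_set p" using x v p by auto
      define N where "N = ell_norm p (\<lambda>n. x n + v k n)"
      have tV: "t powr p * V = (t * W) powr p" using t W by (simp add: V_def powr_mult)
      have "ell_norm p (v k) powr p \<le> (t * W) powr p" using vt p by (intro powr_mono2) auto
      then have Np: "N powr p \<le> 1 + t powr p * V + h" using elim(1) unfolding N_def tV by linarith
      have "0 \<le> t powr p * V" using V by simp
      have "N powr r = (N powr p) powr (r / p)" using p by (simp add: powr_powr)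
      also have "\<dots> \<le> (1 + t powr p * V + h) powr (r / p)" using Np r by (intro powr_mono2) auto
      also have "\<dots> \<le> (1 + t powr p * V + h) powr 1"
        using r p h \<open>0 \<le> t powr p * V\<close> by (intro powr_mono) auto
      finally have Nr: "N powr r \<le> 1 + t powr p * V + h" using h \<open>0 \<le> t powr p * V\<close> by simp
      have "G (\<lambda>n. x n + v k n) powr r \<le> (\<kappa> * N) powr r"
        using elim(2) G\<kappa>[OF m] r unfolding N_def by (intro powr_mono2) auto
      also have "\<dots> = A * N powr r" using \<kappa> by (simp add: A_def powr_mult N_def)
      also have "\<dots> \<le> A * (1 + t powr p * V + h)" using Nr A by (intro mult_left_mono)
      finally have "t powr r * G (w k) powr r \<le> A * (t powr p * V) + (A * h + 2 * h)"
        using elim(2) x(4) by (simp add: algebra_simps)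
      also have "t powr p = t powr (p - r) * t powr r" by (simp flip: powr_add)
      also have "A * (t powr (p - r) * t powr r * V) + (A * h + 2 * h)
          = (A * V * t powr (p - r) + E / 2) * t powr r" using h2 by (simp add: algebra_simps)
      also have "\<dots> < E * t powr r" using t1 t by (intro mult_strict_right_mono) auto
      finally have "t powr r * G (w k) powr r < t powr r * e powr r" by (simp add: E_def mult.commute)
      then have "G (w k) powr r < e powr r" using t by simp
      then show ?case using powr_mono2[of r e "G (w k)"] e r
        by (meson not_less order_less_imp_le le_less_trans zero_le_one dual_order.trans)
    qed
  qed
qed

text \<open>
  The case \<open>r = 1\<close> with the real part of \<open>\<phi>\<close> as \<open>G\<close>, for which the splitting is just additivity.
  Unimodular factors make the values \<open>\<phi> (w k)\<close> nonnegative.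
\<close>

lemma ell_functional_null_seq:
  fixes \<phi> :: "(nat \<Rightarrow> 'a::{real_normed_field, euclidean_space}) \<Rightarrow> 'a"
  assumes p: "1 < p"
    and add: "\<And>x y. \<lbrakk>x \<in> ell_set p; y \<in> ell_set p\<rbrakk> \<Longrightarrow> \<phi> (\<lambda>n. x n + y n) = \<phi> x + \<phi> y"
    and scale: "\<And>c x. x \<in> ell_set p \<Longrightarrow> \<phi> (\<lambda>n. c * x n) = c * \<phi> x"
    and bd: "\<And>x. x \<in> ell_set p \<Longrightarrow> norm (\<phi> x) \<le> K * ell_norm p x"
    and w: "\<And>k. w k \<in> ell_set p" "\<And>k. ell_norm p (w k) \<le> W" "\<And>n. (\<lambda>k. w k n) \<longlonglongrightarrow> 0"
  shows "(\<lambda>k. \<phi> (w k)) \<longlonglongrightarrow> 0"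
proof -
  define c where "c k = (if \<phi> (w k) = 0 then 1 else of_real (norm (\<phi> (w k))) / \<phi> (w k))" for k
  have c: "norm (c k) = 1" "c k * \<phi> (w k) = of_real (norm (\<phi> (w k)))" for k
    by (auto simp: c_def norm_divide)
  define w' where "w' k = (\<lambda>n. c k * w k n)" for k
  define G where "G x = re_part (\<phi> x)" for x
  have w': "w' k \<in> ell_set p" "ell_norm p (w' k) \<le> W" for k
    using w(2)[of k] unfolding w'_def ell_norm_scale[OF w(1) p] c by (auto intro!: ell_scale_mem w)
  have w'0: "(\<lambda>k. w' k n) \<longlonglongrightarrow> 0" for n
    using w(3)[of n] unfolding w'_def tendsto_norm_zero_iff[of "\<lambda>k. w k n", symmetric]
    by (subst tendsto_norm_zero_iff[symmetric]) (simp add: norm_mult c)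
  have Gw': "G (w' k) = norm (\<phi> (w k))" for k
    by (simp add: G_def w'_def scale[OF w(1)] c)
  have Gscale: "G (\<lambda>n. of_real s * x n) = s * G x" if "x \<in> ell_set p" for s x
    unfolding G_def scale[OF that] by (simp add: re_part_scaleR flip: scaleR_conv_of_real)
  have "(\<lambda>k. G (w' k)) \<longlonglongrightarrow> 0"
  proof (rule pitt_vanishing_on_null_seq[of 1 p G K w' W])
    show "G x \<le> K * ell_norm p x" if "x \<in> ell_set p" for x
      using bd[OF that] re_part_le_norm[of "\<phi> x"] by (simp add: G_def)
    fix x :: "nat \<Rightarrow> 'a" and t e :: real assume x: "x \<in> ell_set p" "0 \<le> G x" "0 < t" "0 < e"
    have "G (\<lambda>n. x n + of_real t * w' k n) = G x + t * G (w' k)" for k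
      using Gscale[OF w'(1), of t k] add[OF x(1) ell_scale_mem[OF w'(1)], of "of_real t" k]
      by (simp add: G_def re_part_add)
    then show "\<forall>\<^sub>F k in sequentially. 0 \<le> G (\<lambda>n. x n + of_real t * w' k n) \<and>
        t powr 1 * G (w' k) powr 1 + G x powr 1 \<le> G (\<lambda>n. x n + of_real t * w' k n) powr 1 + e"
      using x by (simp add: Gw')
  qed (use p w' w'0 in \<open>auto simp: Gw' Gscale\<close>)
  then show ?thesis by (simp add: Gw' tendsto_norm_zero_iff)
qed

lemma ell_functional_continuous_pointwise:
  fixes \<phi> :: "(nat \<Rightarrow> 'a::{real_normed_field, euclidean_space}) \<Rightarrow> 'a"
  assumes p: "1 < p"
    and add: "\<And>x y. \<lbrakk>x \<in> ell_set p; y \<in> ell_set p\<rbrakk> \<Longrightarrow> \<phi> (\<lambda>n. x n + y n) = \<phi> x + \<phi> y"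
    and scale: "\<And>c x. x \<in> ell_set p \<Longrightarrow> \<phi> (\<lambda>n. c * x n) = c * \<phi> x"
    and bd: "\<And>x. x \<in> ell_set p \<Longrightarrow> norm (\<phi> x) \<le> K * ell_norm p x"
    and u: "\<And>k. u k \<in> ell_set p" "\<And>k. ell_norm p (u k) \<le> W" "\<And>n. (\<lambda>k. u k n) \<longlonglongrightarrow> z n"
  shows "(\<lambda>k. \<phi> (u k)) \<longlonglongrightarrow> \<phi> z"
proof -
  have z: "z \<in> ell_set p" "ell_norm p z \<le> W" using ell_pointwise_limit[OF p u] by auto
  define w where "w k = (\<lambda>n. u k n - z n)" for k
  have w: "w k \<in> ell_set p" for k unfolding w_def using u z p by auto
  have uw: "u k = (\<lambda>n. z n + w k n)" for k by (auto simp: w_def)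
  have "ell_norm p (w k) \<le> W + W" for k
    using ell_norm_triangle[OF u(1) ell_scale_mem[OF z(1)] p, of k "-1"] u(2)[of k] z
      ell_norm_scale[OF z(1) p, of "-1"] by (simp add: w_def)
  moreover have "(\<lambda>k. w k n) \<longlonglongrightarrow> 0" for n unfolding w_def using u(3) by (simp add: LIM_zero)
  ultimately have "(\<lambda>k. \<phi> (w k)) \<longlonglongrightarrow> 0"
    by (intro ell_functional_null_seq[OF p add scale bd w])
  then have "(\<lambda>k. \<phi> z + \<phi> (w k)) \<longlonglongrightarrow> \<phi> z" by (intro tendsto_eq_intros) auto
  then show ?thesis unfolding uw add[OF z(1) w] .
qed

text \<open>
  Writing \<open>u k = z + w k\<close>, the norm of \<open>u k\<close> splits between \<open>z\<close> and \<open>w k\<close>, and the norm of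
  \<open>T (u k)\<close> splits between \<open>T z\<close> and \<open>T (w k)\<close>. As \<open>T\<close> is a contraction, \<open>T (u k)\<close> can have full
  norm only if nothing is lost on \<open>z\<close>.
\<close>

lemma ell_norm_weak_limit_maximizing:
  fixes T :: "(nat \<Rightarrow> 'a::{real_normed_field, euclidean_space}) \<Rightarrow> nat \<Rightarrow> 'a"
  assumes p: "1 < p" and q: "1 < q"
    and T: "T \<in> bounded_ops (ell p) (ell q)" "vnorm (op_space (ell p) (ell q)) T = 1"
    and u: "\<And>k. u k \<in> ell_set p" "\<And>k. ell_norm p (u k) \<le> 1" "\<And>n. (\<lambda>k. u k n) \<longlonglongrightarrow> z n"
    and Tu: "(\<lambda>k. ell_norm q (T (u k))) \<longlonglongrightarrow> 1"
  shows "ell_norm p z \<le> ell_norm q (T z)"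
proof -
  interpret seminormed_pair "ell p :: ('a, nat \<Rightarrow> 'a) nspace" "ell q"
    using seminormed_pair_ell[OF p q] .
  note Tc = op_closed[OF T(1)]
  have Tadd: "T (\<lambda>n. x n + y n) = (\<lambda>n. T x n + T y n)" if "x \<in> ell_set p" "y \<in> ell_set p" for x y
    using op_add[OF T(1) that] by simp
  have Tscale: "T (\<lambda>n. c * x n) = (\<lambda>n. c * T x n)" if "x \<in> ell_set p" for x c
    using op_scale[OF T(1) that] by simp
  have Tn: "ell_norm q (T x) \<le> ell_norm p x" if "x \<in> ell_set p" for x
    using op_norm_bound[OF T(1) that] T(2) by simp
  have z: "z \<in> ell_set p" "ell_norm p z \<le> 1" using ell_pointwise_limit[OF p u] by auto
  define w where "w k = (\<lambda>n. u k n - z n)" for k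
  have w: "w k \<in> ell_set p" for k unfolding w_def using u z p by auto
  have uw: "u k = (\<lambda>n. z n + w k n)" for k by (auto simp: w_def)
  have w2: "ell_norm p (w k) \<le> 2" for k
    using ell_norm_triangle[OF u(1) ell_scale_mem[OF z(1)] p, of k "-1"] u(2)[of k] z
      ell_norm_scale[OF z(1) p, of "-1"] by (simp add: w_def)
  have w0: "(\<lambda>k. w k n) \<longlonglongrightarrow> 0" for n unfolding w_def using u(3) by (simp add: LIM_zero)
  have Tw2: "ell_norm q (T (w k)) \<le> 2" for k using Tn[OF w, of k] w2[of k] by linarith
  have Tw0: "(\<lambda>k. T (w k) n) \<longlonglongrightarrow> 0" for n
  proof (rule ell_functional_null_seq[OF p, of "\<lambda>x. T x n" 1])
    show "norm (T x n) \<le> 1 * ell_norm p x" if "x \<in> ell_set p" for x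
      using ell_norm_coord[OF Tc[OF that] q, of n] Tn[OF that] by simp
  qed (use w w2 w0 Tadd Tscale in auto)
  have Tuw: "T (u k) = (\<lambda>n. T z n + T (w k) n)" for k unfolding uw using Tadd[OF z(1) w] .
  show ?thesis
  proof (cases "p \<le> q")
    case True
    define a b where "a = ell_norm p z" and "b = ell_norm q (T z)"
    have ab: "0 \<le> a" "a \<le> 1" "0 \<le> b" using z by (auto simp: a_def b_def)
    define d where "d k = ell_norm p (u k) powr p - ell_norm p (w k) powr p" for k
    have d: "d \<longlonglongrightarrow> a powr p"
      using ell_brezis_lieb[OF p z(1) w w2 w0] unfolding d_def a_def uw .
    have "(\<lambda>k. ell_norm q (T (u k)) powr q - ell_norm q (T (w k)) powr q) \<longlonglongrightarrow> b powr q"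
      using ell_brezis_lieb[OF q Tc[OF z(1)] Tc[OF w] Tw2 Tw0] unfolding b_def Tuw .
    moreover have "(\<lambda>k. ell_norm q (T (u k)) powr q) \<longlonglongrightarrow> 1 powr q"
      using q by (intro tendsto_powr' tendsto_const Tu) auto
    ultimately have "(\<lambda>k. ell_norm q (T (u k)) powr q - (ell_norm q (T (u k)) powr q - ell_norm q (T (w k)) powr q))
        \<longlonglongrightarrow> 1 powr q - b powr q" by (intro tendsto_diff)
    then have l: "(\<lambda>k. ell_norm q (T (w k)) powr q) \<longlonglongrightarrow> 1 - b powr q" by simp
    have wd: "ell_norm p (w k) powr p \<le> 1 - d k" for k
      using u(2)[of k] p powr_mono2[of p "ell_norm p (u k)" 1] by (simp add: d_def)
    have dnn: "0 \<le> 1 - d k" for k by (rule order_trans[OF _ wd]) simp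
    have r: "(\<lambda>k. (1 - d k) powr (q / p)) \<longlonglongrightarrow> (1 - a powr p) powr (q / p)"
      using p q dnn by (intro tendsto_powr' tendsto_intros d) auto
    have "ell_norm q (T (w k)) powr q \<le> (1 - d k) powr (q / p)" for k
    proof -
      have "ell_norm q (T (w k)) powr q \<le> ell_norm p (w k) powr q"
        using Tn[OF w] q by (intro powr_mono2) auto
      also have "\<dots> = (ell_norm p (w k) powr p) powr (q / p)" using p by (simp add: powr_powr)
      also have "\<dots> \<le> (1 - d k) powr (q / p)" using wd p q by - (rule powr_mono2, auto)
      finally show ?thesis .
    qed
    then have "1 - b powr q \<le> (1 - a powr p) powr (q / p)"
      by (intro LIMSEQ_le[OF l r]) auto
    \<comment> \<open>Here p \<le> q enters, twice: powers of numbers in the unit interval decrease with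
      the exponent.\<close>
    also have "\<dots> \<le> (1 - a powr p) powr 1"
      using ab p True powr_mono2[of p a 1] by (intro powr_mono') auto
    also have "\<dots> = 1 - a powr p" using ab p powr_mono2[of p a 1] by simp
    also have "\<dots> \<le> 1 - a powr q" using ab True powr_mono'[of p q a] by simp
    finally have "a powr q \<le> b powr q" by simp
    then show ?thesis using ab q powr_less_mono2[of q b a] by (force simp: a_def[symmetric] b_def[symmetric] not_le[symmetric])
  next
    case False
    then have qp: "q < p" by simp
    \<comment> \<open>Pitt's theorem; the splitting of q-th powers in the target exponent q provides
      the gain.\<close>
    have "(\<lambda>k. ell_norm q (T (w k))) \<longlonglongrightarrow> 0"
    proof (rule pitt_vanishing_on_null_seq[of q p "\<lambda>x. ell_norm q (T x)" 1 w 2])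
      fix x :: "nat \<Rightarrow> 'a" and t e :: real
      assume x: "x \<in> ell_set p" and t: "0 < t" and e: "0 < e"
      have v: "(\<lambda>n. of_real t * T (w k) n) \<in> ell_set q" for k by (intro ell_scale_mem Tc w)
      have vn: "ell_norm q (\<lambda>n. of_real t * T (w k) n) = t * ell_norm q (T (w k))" for k
        unfolding ell_norm_scale[OF Tc[OF w] q] using t by simp
      have vt: "ell_norm q (\<lambda>n. of_real t * T (w k) n) \<le> t * 2" for k unfolding vn using Tw2 t by simp
      have v0: "(\<lambda>k. of_real t * T (w k) n) \<longlonglongrightarrow> 0" for n by (rule tendsto_mult_right_zero[OF Tw0])
      have eq: "T (\<lambda>n. x n + of_real t * w k n) = (\<lambda>n. T x n + of_real t * T (w k) n)" for k
        using Tadd[OF x ell_scale_mem[OF w]] Tscale[OF w] by simp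
      have "\<forall>\<^sub>F k in sequentially. ell_norm q (T x) powr q - e <
          ell_norm q (\<lambda>n. T x n + of_real t * T (w k) n) powr q - ell_norm q (\<lambda>n. of_real t * T (w k) n) powr q"
        using e by (intro order_tendstoD(1)[OF ell_brezis_lieb[OF q Tc[OF x] v vt v0]]) auto
      then show "\<forall>\<^sub>F k in sequentially. 0 \<le> ell_norm q (T (\<lambda>n. x n + of_real t * w k n)) \<and>
        t powr q * ell_norm q (T (w k)) powr q + ell_norm q (T x) powr q
          \<le> ell_norm q (T (\<lambda>n. x n + of_real t * w k n)) powr q + e"
        unfolding eq vn by (rule eventually_mono) (use t in \<open>simp add: powr_mult\<close>)
    next
      show "ell_norm q (T (\<lambda>n. of_real s * x n)) = s * ell_norm q (T x)"
        if "0 \<le> s" "x \<in> ell_set p" for s x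
        unfolding Tscale[OF that(2)] ell_norm_scale[OF Tc[OF that(2)] q] using that by simp
    qed (use q qp w w2 w0 Tn in auto)
    then have "(\<lambda>k. ell_norm q (T z) + ell_norm q (T (w k))) \<longlonglongrightarrow> ell_norm q (T z)"
      by (intro tendsto_eq_intros) auto
    then have "1 \<le> ell_norm q (T z)"
      using ell_norm_triangle[OF Tc[OF z(1)] Tc[OF w] q] unfolding Tuw[symmetric]
      by (intro LIMSEQ_le[OF Tu]) auto
    then show ?thesis using z by simp
  qed
qed

section \<open>Norming functionals\<close>

lemma norming_functional_le_quotient:
  fixes X :: "('a::{real_normed_field, real_inner}, 'v) nspace"
  assumes X: "seminormed_nspace X" and fu: "f \<in> norming_functionals X u" and u: "u \<in> vcarrier X" and x: "x \<in> vcarrier X" and t: "0 < t"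
  shows "re_part (f x) \<le> (vnorm X (vadd X u (vscale X (of_real t) x)) - vnorm X u) / t"
proof -
  interpret seminormed_nspace X by (rule X)
  interpret D: seminormed_pair X scalar_space
    by (intro seminormed_pair.intro X seminormed_scalar)
  have f: "f \<in> bounded_ops X scalar_space" "vnorm (op_space X scalar_space) f = 1" "f u = of_real (vnorm X u)"
    using fu by (auto simp: norming_functionals_def unit_sphere_def dual_space_def op_space_def)
  have tx: "vscale X (of_real t) x \<in> vcarrier X" using x by (simp add: scale_closed)
  have "f (vadd X u (vscale X (of_real t) x)) = of_real (vnorm X u) + of_real t * f x"
    using D.op_add[OF f(1) u tx] D.op_scale[OF f(1) x] f(3) by (simp add: scalar_space_def)
  then have "vnorm X u + t * re_part (f x) = re_part (f (vadd X u (vscale X (of_real t) x)))"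
    by (simp add: re_part_add re_part_scaleR flip: scaleR_conv_of_real)
  also have "\<dots> \<le> norm (f (vadd X u (vscale X (of_real t) x)))" by (rule re_part_le_norm)
  also have "\<dots> \<le> vnorm X (vadd X u (vscale X (of_real t) x))"
    using D.op_norm_bound[OF f(1) add_closed[OF u tx]] f(2) by (simp add: scalar_space_def)
  finally show ?thesis using t by (simp add: field_simps)
qed

text \<open>
  Functionals dominated by the norm form a compact set for pointwise convergence, and linearity,
  the value at \<open>u\<close> and the limit of the real parts at \<open>x\<close> are closed conditions, so they pass to
  a cluster point.
\<close>

lemma norming_functional_cluster_point:
  fixes X :: "('a::{real_normed_field, euclidean_space}, 'v) nspace"
  assumes X: "seminormed_nspace X" and u: "u \<in> vcarrier X" "vnorm X u = 1" and x: "x \<in> vcarrier X"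
    and add: "\<And>k y z. \<lbrakk>y \<in> vcarrier X; z \<in> vcarrier X\<rbrakk> \<Longrightarrow> g k (vadd X y z) = g k y + g k z"
    and scale: "\<And>k c y. y \<in> vcarrier X \<Longrightarrow> g k (vscale X c y) = c * g k y"
    and bound: "\<And>k y. y \<in> vcarrier X \<Longrightarrow> norm (g k y) \<le> vnorm X y"
    and gu: "\<And>k. g k u = 1"
    and lim: "(\<lambda>k. re_part (g k x)) \<longlonglongrightarrow> s"
  obtains f where "f \<in> norming_functionals X u" "re_part (f x) = s"
proof -
  interpret seminormed_nspace X by (rule X)
  interpret D: seminormed_pair X scalar_space
    by (intro seminormed_pair.intro X seminormed_scalar)
  define B where "B y = (if y \<in> vcarrier X then vnorm X y else 0)" for y
  \<comment> \<open>Setting the values outside the carrier to zero keeps the sequence in a compact set.\<close>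
  define h where "h k y = (if y \<in> vcarrier X then g k y else 0)" for k y
  define F where "F = filtermap h sequentially"
  have "F \<noteq> bot" by (simp add: F_def filtermap_bot_iff)
  moreover have "eventually (\<lambda>f. f \<in> {f. \<forall>y. norm (f y) \<le> B y}) F"
    using bound by (simp add: F_def eventually_filtermap h_def B_def)
  ultimately obtain f where f: "\<forall>y. norm (f y) \<le> B y" "inf (nhds f) F \<noteq> bot"
    using compact_pointwise_bounded[where B = B and 'b = 'a] unfolding compact_filter by blast
  \<comment> \<open>A cluster point lies in every closed set that eventually contains the sequence.\<close>
  have closed_in: "f \<in> C" if C: "closed C" "eventually (\<lambda>k. h k \<in> C) sequentially" for C
  proof (rule ccontr)
    assume "f \<notin> C"
    then have "eventually (\<lambda>f. f \<in> - C) (nhds f)" using C(1) by (intro eventually_nhds_in_open) auto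
    moreover have "eventually (\<lambda>f. f \<in> C) F" using C(2) by (simp add: F_def eventually_filtermap)
    ultimately have "eventually (\<lambda>f. False) (inf (nhds f) F)"
      unfolding eventually_inf by fastforce
    then show False using f(2) by (simp add: trivial_limit_def)
  qed
  note cont = continuous_on_product_coordinates
  have fadd: "f (vadd X y z) = f y + f z" if "y \<in> vcarrier X" "z \<in> vcarrier X" for y z
  proof -
    have "closed {f :: 'v \<Rightarrow> 'a. f (vadd X y z) = f y + f z}"
      by (intro closed_Collect_eq continuous_intros cont)
    from closed_in[OF this] show ?thesis using that add by (simp add: h_def add_closed)
  qed
  have fscale: "f (vscale X c y) = c * f y" if "y \<in> vcarrier X" for c y
  proof -
    have "closed {f :: 'v \<Rightarrow> 'a. f (vscale X c y) = c * f y}"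
      by (intro closed_Collect_eq continuous_intros cont)
    from closed_in[OF this] show ?thesis using that scale by (simp add: h_def scale_closed)
  qed
  have fu: "f u = 1"
  proof -
    have "closed {f :: 'v \<Rightarrow> 'a. f u = 1}" by (intro closed_Collect_eq continuous_intros cont)
    from closed_in[OF this] show ?thesis using u gu by (simp add: h_def)
  qed
  have "\<bar>re_part (f x) - s\<bar> \<le> e" if e: "e > 0" for e
  proof -
    have "closed {f :: 'v \<Rightarrow> 'a. \<bar>re_part (f x) - s\<bar> \<le> e}"
      by (intro closed_Collect_le continuous_on_const continuous_on_rabs continuous_on_diff
          bounded_linear.continuous_on[OF bounded_linear_re_part cont])
    moreover have "eventually (\<lambda>k. \<bar>re_part (h k x) - s\<bar> \<le> e) sequentially"
      using tendstoD[OF lim e] by eventually_elim (use x in \<open>simp add: h_def dist_real_def\<close>)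
    ultimately show ?thesis using closed_in[of "{f. \<bar>re_part (f x) - s\<bar> \<le> e}"] by simp
  qed
  then have fx: "re_part (f x) = s" using field_le_epsilon[of "\<bar>re_part (f x) - s\<bar>" 0] by simp
  define f' where "f' = restrict f (vcarrier X)"
  have fb: "norm (f y) \<le> vnorm X y" if "y \<in> vcarrier X" for y
    using f(1) that unfolding B_def by (metis (full_types))
  have f': "f' \<in> bounded_ops X scalar_space"
  proof -
    have "\<exists>K. \<forall>y\<in>vcarrier X. norm (f y) \<le> K * vnorm X y"
      by (rule exI[of _ 1]) (simp add: fb)
    then show ?thesis
      by (auto simp: bounded_ops_def f'_def scalar_space_def add_closed scale_closed fadd fscale)
  qed
  have "vnorm (op_space X scalar_space) f' = 1"
  proof (rule antisym)
    show "vnorm (op_space X scalar_space) f' \<le> 1"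
      by (rule D.op_norm_leI) (auto simp: unit_ball_def f'_def scalar_space_def intro: order_trans[OF fb])
    have "u \<in> unit_ball X" using u by (simp add: unit_ball_def)
    from D.op_norm_ge[OF f' this] show "1 \<le> vnorm (op_space X scalar_space) f'"
      using u fu by (simp add: f'_def scalar_space_def)
  qed
  then have "f' \<in> norming_functionals X u"
    using f' u fu by (auto simp: norming_functionals_def unit_sphere_def dual_space_def f'_def op_space_def)
  moreover have "re_part (f' x) = s" using fx x by (simp add: f'_def)
  ultimately show ?thesis by (rule that)
qed

section \<open>Operators of norm one\<close>

locale norm_one_ell_op =
  fixes p q :: real and T :: "(nat \<Rightarrow> 'a::{real_normed_field, euclidean_space}) \<Rightarrow> nat \<Rightarrow> 'a"
  assumes p: "1 < p" and q: "1 < q"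
    and T: "T \<in> bounded_ops (ell p) (ell q)" and norm_T: "vnorm (op_space (ell p) (ell q)) T = 1"
begin

sublocale seminormed_pair "ell p :: ('a, nat \<Rightarrow> 'a) nspace" "ell q"
  using seminormed_pair_ell[OF p q] .

abbreviation ops :: "('a, (nat \<Rightarrow> 'a) \<Rightarrow> nat \<Rightarrow> 'a) nspace" where
  "ops \<equiv> op_space (ell p) (ell q)"

abbreviation attaining :: "(nat \<Rightarrow> 'a) set" where
  "attaining \<equiv> norm_attaining_set (ell p) (ell q) T"

definition diff_quot :: "real \<Rightarrow> ((nat \<Rightarrow> 'a) \<Rightarrow> nat \<Rightarrow> 'a) \<Rightarrow> real" where
  "diff_quot t S = (vnorm ops (vadd ops T (vscale ops (of_real t) S)) - vnorm ops T) / t"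

lemma carrier_ops [simp]: "vcarrier ops = bounded_ops (ell p) (ell q)"
  by (simp add: op_space_def)

sublocale ops: seminormed_nspace ops
  using seminormed_op_space T by blast

lemma perturbation_apply:
  "vadd ops T (vscale ops (of_real t) S) x = (\<lambda>n. T x n + of_real t * S x n)" if "x \<in> ell_set p"
  using that by (simp add: op_space_def)

lemma perturbation_closed:
  "vadd ops T (vscale ops (of_real t) S) \<in> bounded_ops (ell p) (ell q)" if "S \<in> bounded_ops (ell p) (ell q)"
  using ops.add_closed[of T "vscale ops (of_real t) S"] ops.scale_closed[of S "of_real t"] T that by simp

lemma norm_perturbation: "vnorm ops (vadd ops T (vscale ops (of_real t) S)) = 1 + t * diff_quot t S" if "0 < t"
  using that by (simp add: diff_quot_def norm_T)

lemma attaining_iff: "x \<in> attaining \<longleftrightarrow> x \<in> ell_set p \<and> ell_norm p x = 1 \<and> ell_norm q (T x) = 1"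
  by (auto simp: norm_attaining_set_def unit_sphere_def norm_T)

lemma norm_T_le: "ell_norm q (T x) \<le> ell_norm p x" if "x \<in> ell_set p"
  using op_norm_bound[OF T that] norm_T by simp

lemma T_scale: "T (\<lambda>n. c * x n) = (\<lambda>n. c * T x n)" if "x \<in> ell_set p"
  using op_scale[OF T that] by simp

lemma norm_contraction: "ell_norm q (S x) \<le> ell_norm p x" if "S \<in> unit_ball ops" "x \<in> ell_set p"
proof -
  have "ell_norm q (S x) \<le> vnorm ops S * ell_norm p x"
    using that by (intro op_norm_bound) (auto simp: unit_ball_def)
  also have "\<dots> \<le> 1 * ell_norm p x" using that by (intro mult_right_mono) (auto simp: unit_ball_def)
  finally show ?thesis by simp
qed

lemma attaining_scale: "(\<lambda>n. c * x n) \<in> attaining" if "x \<in> attaining" "norm c = 1"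
  using that op_closed[OF T, of x]
  by (auto simp: attaining_iff T_scale ell_norm_scale p q)

lemma vdist_set_le: "vdist_set (ell p) x attaining \<le> ell_norm p (\<lambda>n. x n - m n)" if "m \<in> attaining"
proof -
  have "bdd_below (vdist (ell p) x ` attaining)" by (rule bdd_belowI2[of _ 0]) (simp add: vdist_def)
  from cINF_lower[OF this that] show ?thesis by (simp add: vdist_set_def vdist_def)
qed

lemma vdist_set_nonneg: "0 \<le> vdist_set (ell p) x attaining" if "attaining \<noteq> {}"
  unfolding vdist_set_def using that by (intro cINF_greatest) (auto simp: vdist_def)

section \<open>From strong subdifferentiability to maximizing sequences\<close>

text \<open>
  For a unit vector \<open>x\<close> almost norming \<open>T\<close>, adding \<open>t\<close> times this contraction increases the norm
  of \<open>T\<close> by almost \<open>t\<close>.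
\<close>

definition rank_one :: "(nat \<Rightarrow> 'a) \<Rightarrow> (nat \<Rightarrow> 'a) \<Rightarrow> nat \<Rightarrow> 'a" where
  "rank_one x = (\<lambda>y\<in>ell_set p. \<lambda>n. ell_pair p x y * T x n)"

lemma rank_one_mem:
  assumes x: "x \<in> ell_set p" "ell_norm p x = 1"
  shows "rank_one x \<in> unit_ball ops"
proof -
  note Tx = op_closed[OF T x(1)]
  have n: "ell_norm q (\<lambda>n. c * T x n) \<le> norm c" for c
    using norm_T_le[OF x(1)] x(2) unfolding ell_norm_scale[OF Tx q] by (simp add: mult_left_le)
  have b: "ell_norm q (rank_one x y) \<le> 1 * ell_norm p y" if "y \<in> ell_set p" for y
    using n[of "ell_pair p x y"] ell_pair_le[OF x(1) that p x(2)] that by (simp add: rank_one_def)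
  have m: "(\<lambda>n. c * T x n) \<in> ell_set q" for c by (rule ell_scale_mem[OF Tx])
  have "rank_one x \<in> bounded_ops (ell p) (ell q)"
    unfolding bounded_ops_def
  proof (intro CollectI conjI ballI allI)
    show "rank_one x \<in> ell_set p \<rightarrow>\<^sub>E ell_set q" using m by (auto simp: rank_one_def)
    show "\<exists>K. \<forall>y\<in>ell_set p. ell_norm q (rank_one x y) \<le> K * ell_norm p y" using b by blast
    show "rank_one x (vscale (ell p) c y) = vscale (ell q) c (rank_one x y)"
      if "y \<in> ell_set p" for y :: "nat \<Rightarrow> 'a" and c
      using that ell_scale_mem[OF that, of c] by (simp add: rank_one_def ell_pair_scale[OF x(1) that p] mult.assoc)
    show "rank_one x (vadd (ell p) y z) = vadd (ell q) (rank_one x y) (rank_one x z)"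
      if "y \<in> ell_set p" "z \<in> ell_set p" for y z :: "nat \<Rightarrow> 'a"
      using that ell_add_mem[OF that p] by (simp add: rank_one_def ell_pair_add[OF x(1) that p] distrib_right)
  qed
  moreover have "vnorm ops (rank_one x) \<le> 1"
    by (rule op_norm_leI) (use b in \<open>force simp: unit_ball_def\<close>)
  ultimately show ?thesis by (simp add: unit_ball_def)
qed

text \<open>
  A vector \<open>u k\<close> almost norming \<open>T + t\<^sub>k S\<close> must satisfy \<open>\<parallel>S (u k)\<parallel> \<ge> L - o(1)\<close> and
  \<open>\<parallel>T (u k)\<parallel> \<rightarrow> 1\<close>. As \<open>S\<close> has rank one, the first property survives in the weak limit \<open>z\<close>, which
  is therefore nonzero, and the second yields that \<open>T\<close> preserves the norm of \<open>z\<close>. Normalizing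
  \<open>z\<close>, whose norm is at most \<open>1\<close>, only increases the pairing.
\<close>

lemma attaining_point_of_rank_one:
  assumes x: "x \<in> ell_set p" "ell_norm p x = 1" and L: "0 < L"
    and lim: "((\<lambda>t. diff_quot t (rank_one x)) \<longlongrightarrow> L) (at_right 0)"
  obtains z where "z \<in> attaining" "L \<le> norm (ell_pair p x z)"
proof -
  define S where "S = rank_one x"
  have S: "S \<in> unit_ball ops" "S \<in> bounded_ops (ell p) (ell q)"
    using rank_one_mem[OF x] by (auto simp: S_def unit_ball_def)
  define t where "t k = 1 / real (Suc k)" for k
  have t: "0 < t k" for k by (simp add: t_def)
  have t0: "t \<longlonglongrightarrow> 0" unfolding t_def by (rule LIMSEQ_Suc[OF lim_1_over_n])
  then have "filterlim t (at_right 0) sequentially"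
    using t by (auto simp: filterlim_at less_imp_neq[THEN not_sym] intro!: always_eventually)
  define Q where "Q k = diff_quot (t k) S" for k
  have Q: "Q \<longlonglongrightarrow> L" using filterlim_compose[OF lim \<open>filterlim t (at_right 0) sequentially\<close>]
    by (simp add: Q_def[abs_def] S_def)
  have "\<exists>u. u \<in> unit_ball (ell p) \<and> 1 + t k * Q k - t k * t k < ell_norm q (\<lambda>n. T u n + of_real (t k) * S u n)" for k
  proof -
    have "1 + t k * Q k - t k * t k < vnorm ops (vadd ops T (vscale ops (of_real (t k)) S))"
      unfolding norm_perturbation[OF t] Q_def using t[of k] by simp
    then obtain u where u: "u \<in> unit_ball (ell p)"
      "1 + t k * Q k - t k * t k < ell_norm q (vadd ops T (vscale ops (of_real (t k)) S) u)"
      using op_norm_approx by blast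
    then show ?thesis using perturbation_apply[of u "t k" S] by (auto simp: unit_ball_def)
  qed
  then obtain u where u: "\<And>k. u k \<in> unit_ball (ell p)"
    and uQ: "\<And>k. 1 + t k * Q k - t k * t k < ell_norm q (\<lambda>n. T (u k) n + of_real (t k) * S (u k) n)"
    by metis
  have ue: "u k \<in> ell_set p" "ell_norm p (u k) \<le> 1" for k using u by (auto simp: unit_ball_def)
  have le: "1 + t k * Q k - t k * t k < ell_norm q (T (u k)) + t k * ell_norm q (S (u k))" for k
    using uQ[of k] ell_norm_triangle[OF op_closed[OF T ue(1)] ell_scale_mem[OF op_closed[OF S(2) ue(1)]] q, of k "of_real (t k)" k]
      ell_norm_scale[OF op_closed[OF S(2) ue(1)] q, of "of_real (t k)" k] t[of k] by simp
  have Tu1: "ell_norm q (T (u k)) \<le> 1" and Su1: "ell_norm q (S (u k)) \<le> 1" for k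
    using norm_T_le[OF ue(1), of k] norm_contraction[OF S(1) ue(1), of k] ue(2)[of k] by auto
  have Su: "Q k - t k \<le> ell_norm q (S (u k))" for k
  proof -
    have "t k * (Q k - t k) < t k * ell_norm q (S (u k))"
      using le[of k] Tu1[of k] by (simp add: right_diff_distrib)
    then show ?thesis using t[of k] by simp
  qed
  have Tu: "(\<lambda>k. ell_norm q (T (u k))) \<longlonglongrightarrow> 1"
  proof (rule tendsto_sandwich)
    show "(\<lambda>k. 1 + t k * Q k - t k * t k - t k) \<longlonglongrightarrow> 1" by (rule tendsto_eq_intros t0 Q refl | simp)+
    have "t k * ell_norm q (S (u k)) \<le> t k" for k using Su1[of k] t[of k] by (simp add: mult_left_le)
    then have "1 + t k * Q k - t k * t k - t k \<le> ell_norm q (T (u k))" for k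
      using le[of k] by (smt (verit))
    then show "\<forall>\<^sub>F k in sequentially. 1 + t k * Q k - t k * t k - t k \<le> ell_norm q (T (u k))" by simp
  qed (use Tu1 in auto)
  obtain z r where r: "strict_mono (r :: nat \<Rightarrow> nat)" and z: "z \<in> ell_set p" "ell_norm p z \<le> 1"
    and uz: "\<And>n. (\<lambda>k. u (r k) n) \<longlonglongrightarrow> z n"
    using ell_pointwise_convergent_subseq[where u = u, OF p ue] by blast
  have "ell_norm p z \<le> ell_norm q (T z)"
    using LIMSEQ_subseq_LIMSEQ[OF Tu r]
    by (intro ell_norm_weak_limit_maximizing[OF p q T norm_T _ _ uz]) (auto simp: ue o_def)
  then have Tz: "ell_norm q (T z) = ell_norm p z" using norm_T_le[OF z(1)] by simp
  have "(\<lambda>k. ell_pair p x (u (r k))) \<longlonglongrightarrow> ell_pair p x z"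
    by (rule ell_functional_continuous_pointwise[OF p ell_pair_add[OF x(1) _ _ p] ell_pair_scale[OF x(1) _ p], where K = 1 and W = 1])
      (use ell_pair_le[OF x(1) _ p x(2)] ue uz in auto)
  then have lim1: "(\<lambda>k. norm (ell_pair p x (u (r k)))) \<longlonglongrightarrow> norm (ell_pair p x z)" by (rule tendsto_norm)
  have lim2: "(\<lambda>k. Q (r k) - t (r k)) \<longlonglongrightarrow> L - 0"
    using LIMSEQ_subseq_LIMSEQ[OF Q r] LIMSEQ_subseq_LIMSEQ[OF t0 r] by (intro tendsto_diff) (auto simp: o_def)
  have "Q k - t k \<le> norm (ell_pair p x (u k))" for k
  proof -
    have "ell_norm q (S (u k)) = norm (ell_pair p x (u k)) * ell_norm q (T x)"
      unfolding S_def rank_one_def using ue(1) ell_norm_scale[OF op_closed[OF T x(1)] q] by simp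
    also have "\<dots> \<le> norm (ell_pair p x (u k))" using norm_T_le[OF x(1)] x(2) by (simp add: mult_left_le)
    finally show ?thesis using Su[of k] by simp
  qed
  then have Lz: "L \<le> norm (ell_pair p x z)" using LIMSEQ_le[OF lim2 lim1] by auto
  define s where "s = ell_norm p z"
  have s: "0 < s" "s \<le> 1" using ell_pair_le[OF x(1) z(1) p x(2)] Lz L z(2) by (auto simp: s_def)
  have sz: "ell_norm p (\<lambda>n. of_real (1/s) * z n) = 1" "ell_norm q (T (\<lambda>n. of_real (1/s) * z n)) = 1"
    unfolding ell_norm_scale[OF z(1) p] T_scale[OF z(1)] ell_norm_scale[OF op_closed[OF T z(1)] q] Tz
    using s by (simp_all add: norm_divide s_def[symmetric])
  have "(\<lambda>n. of_real (1/s) * z n) \<in> attaining"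
    unfolding attaining_iff by (intro conjI ell_scale_mem[OF z(1)] sz)
  moreover have "L \<le> norm (ell_pair p x (\<lambda>n. of_real (1/s) * z n))"
  proof -
    have "L \<le> norm (ell_pair p x z)" by fact
    also have "\<dots> \<le> norm (ell_pair p x z) / s" using s by (simp add: pos_le_divide_eq mult_left_le)
    also have "\<dots> = norm (ell_pair p x (\<lambda>n. of_real (1/s) * z n))"
      unfolding ell_pair_scale[OF x(1) z(1) p] using s by (simp add: norm_mult norm_divide)
    finally show ?thesis .
  qed
  ultimately show ?thesis by (rule that)
qed

text \<open>
  One \<open>t\<close> serves all the operators \<open>rank_one (x n)\<close> by uniformity, which shows that \<open>G\<close> is
  almost \<open>1\<close> on them, so the norming functional of \<open>x n\<close> is almost \<open>1\<close> in modulus at some point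
  of the norm attaining set. After multiplication by a unimodular scalar this point is close to
  \<open>x n\<close>.
\<close>

lemma maximizing_seq_approaches_attaining:
  assumes ssd: "uniform_limit (unit_ball ops) diff_quot G (at_right 0)"
    and x: "maximizing_seq (ell p) (ell q) T x" and e: "0 < e"
  shows "eventually (\<lambda>n. \<exists>m\<in>attaining. ell_norm p (\<lambda>i. x n i - m i) \<le> e) sequentially"
proof -
  have xs: "x n \<in> ell_set p" "ell_norm p (x n) = 1" for n
    using x by (auto simp: maximizing_seq_def unit_sphere_def)
  have Tx: "(\<lambda>n. ell_norm q (T (x n))) \<longlonglongrightarrow> 1" using x by (simp add: maximizing_seq_def norm_T)
  obtain d where d: "0 < d" "\<And>y z :: nat \<Rightarrow> 'a.
      \<lbrakk>y \<in> ell_set p; z \<in> ell_set p; ell_norm p y = 1; ell_norm p z = 1;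
       1 - d \<le> re_part (ell_pair p y z)\<rbrakk> \<Longrightarrow> ell_norm p (\<lambda>n. y n - z n) \<le> e"
    using ell_uniformly_convex[OF p e] by blast
  define h where "h = min d 1 / 2"
  have h: "0 < h" "2 * h \<le> d" "2 * h \<le> 1" using d by (auto simp: h_def)
  have "eventually (\<lambda>t. 0 < t \<and> (\<forall>S\<in>unit_ball ops. dist (diff_quot t S) (G S) < h)) (at_right (0::real))"
    using uniform_limitD[OF ssd h(1)] eventually_at_right_less[of "0::real"] by eventually_elim simp
  then obtain t where t: "0 < t" and tG: "\<And>S. S \<in> unit_ball ops \<Longrightarrow> dist (diff_quot t S) (G S) < h"
    using eventually_happens'[OF trivial_limit_at_right_real] by blast
  \<comment> \<open>As rank_one (x n) maps x n to T (x n), the perturbed operator stretches x n by (1 +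
    t) times the norm of T (x n).\<close>
  have "(\<lambda>n. (1 + t) * ell_norm q (T (x n))) \<longlonglongrightarrow> (1 + t) * 1" by (intro tendsto_intros Tx)
  then have "eventually (\<lambda>n. 1 + t - t * h < (1 + t) * ell_norm q (T (x n))) sequentially"
    using t h by (intro order_tendstoD(1)[where y = "(1 + t) * 1"]) auto
  then show ?thesis
  proof eventually_elim
    case (elim n)
    define S where "S = rank_one (x n)"
    have S: "S \<in> unit_ball ops" unfolding S_def using rank_one_mem[OF xs] .
    then have Sb: "S \<in> bounded_ops (ell p) (ell q)" by (simp add: unit_ball_def)
    have xb: "x n \<in> unit_ball (ell p)" using xs by (simp add: unit_ball_def)
    have "vadd ops T (vscale ops (of_real t) S) (x n) = (\<lambda>i. of_real (1 + t) * T (x n) i)"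
      unfolding perturbation_apply[OF xs(1)] S_def rank_one_def
      using xs[of n] ell_pair_self[OF xs(1) p, of n] by (simp add: algebra_simps)
    then have "ell_norm q (vadd ops T (vscale ops (of_real t) S) (x n)) = (1 + t) * ell_norm q (T (x n))"
      using ell_norm_scale[OF op_closed[OF T xs(1)] q, of "of_real (1 + t)"] t unfolding norm_of_real by simp
    then have "1 + t - t * h < 1 + t * diff_quot t S"
      using op_norm_ge[OF perturbation_closed[OF Sb] xb, of t] elim unfolding norm_perturbation[OF t] by simp
    then have "t * (1 - h) < t * diff_quot t S" by (simp add: right_diff_distrib)
    then have "1 - h < diff_quot t S" using t by (simp del: times_divide_eq_right)
    then have GS: "1 - 2 * h < G S" using tG[OF S] unfolding dist_real_def by linarith
    have "((\<lambda>t. diff_quot t S) \<longlongrightarrow> G S) (at_right 0)"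
      using tendsto_uniform_limitI[OF ssd S] .
    moreover have "0 < G S" using GS h by linarith
    ultimately obtain z where z: "z \<in> attaining" "G S \<le> norm (ell_pair p (x n) z)"
      using attaining_point_of_rank_one[OF xs[of n]] unfolding S_def by metis
    define a where "a = ell_pair p (x n) z"
    have a: "a \<noteq> 0" using z(2) \<open>0 < G S\<close> by (auto simp: a_def)
    define c where "c = of_real (norm a) / a"
    have c: "norm c = 1" "c * a = of_real (norm a)" using a by (auto simp: c_def norm_divide)
    have zc: "(\<lambda>i. c * z i) \<in> attaining" using attaining_scale[OF z(1) c(1)] .
    have "re_part (ell_pair p (x n) (\<lambda>i. c * z i)) = norm a"
      using z(1) ell_pair_scale[OF xs(1) _ p, of z n c] c(2) by (simp add: attaining_iff a_def)
    then have "ell_norm p (\<lambda>i. x n i - c * z i) \<le> e"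
      using zc xs GS h z(2) by (intro d(2)) (auto simp: attaining_iff a_def)
    with zc show ?case by (intro bexI[where x = "\<lambda>i. c * z i"])
  qed
qed

lemma maximizing_seqI:
  assumes x: "\<And>n. x n \<in> unit_sphere (ell p)" "\<And>n. 1 - 1 / real (Suc n) < ell_norm q (T (x n))"
  shows "maximizing_seq (ell p) (ell q) T x"
proof -
  have "(\<lambda>n. ell_norm q (T (x n))) \<longlonglongrightarrow> 1"
  proof (rule tendsto_sandwich)
    show "(\<lambda>n. 1 - 1 / real (Suc n)) \<longlonglongrightarrow> 1"
      using tendsto_diff[OF tendsto_const LIMSEQ_Suc[OF lim_1_over_n], of "1::real"] by simp
    show "\<forall>\<^sub>F n in sequentially. 1 - 1 / real (Suc n) \<le> ell_norm q (T (x n))"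
      using x(2) by (simp add: less_imp_le)
    have "ell_norm q (T (x n)) \<le> 1" for n using norm_T_le[of "x n"] x(1)[of n] by (simp add: unit_sphere_def)
    then show "\<forall>\<^sub>F n in sequentially. ell_norm q (T (x n)) \<le> 1" by simp
  qed simp
  then show ?thesis using x(1) by (simp add: maximizing_seq_def norm_T)
qed

lemma exists_maximizing_seq: "\<exists>x. maximizing_seq (ell p) (ell q) T x"
proof -
  have "\<exists>x. x \<in> unit_sphere (ell p) \<and> 1 - 1 / real (Suc n) < ell_norm q (T x)" for n
  proof -
    have "0 \<le> 1 - 1 / real (Suc n)" "1 - 1 / real (Suc n) < vnorm ops T" by (simp_all add: norm_T)
    from op_norm_approx_sphere[OF T this] show ?thesis by blast
  qed
  then obtain x where x: "\<And>n. x n \<in> unit_sphere (ell p)" "\<And>n. 1 - 1 / real (Suc n) < ell_norm q (T (x n))"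
    by metis
  then show ?thesis using maximizing_seqI by blast
qed

lemma ssd_imp_maximizing_seq_converges:
  assumes ssd: "uniform_limit (unit_ball ops) diff_quot G (at_right 0)"
  shows "attaining \<noteq> {}"
    and "maximizing_seq (ell p) (ell q) T x \<Longrightarrow> (\<lambda>n. vdist_set (ell p) (x n) attaining) \<longlonglongrightarrow> 0"
proof -
  obtain y where "maximizing_seq (ell p) (ell q) T y" using exists_maximizing_seq by blast
  from eventually_happens[OF maximizing_seq_approaches_attaining[OF ssd this zero_less_one]]
  show ne: "attaining \<noteq> {}" by auto
  assume x: "maximizing_seq (ell p) (ell q) T x"
  show "(\<lambda>n. vdist_set (ell p) (x n) attaining) \<longlonglongrightarrow> 0"
  proof (rule order_tendstoI)
    fix a :: real assume "a < 0"
    then show "eventually (\<lambda>n. a < vdist_set (ell p) (x n) attaining) sequentially"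
      using vdist_set_nonneg[OF ne] by (auto intro!: always_eventually intro: less_le_trans)
  next
    fix a :: real assume a: "0 < a"
    then have "0 < a / 2" by simp
    from maximizing_seq_approaches_attaining[OF ssd x this]
    show "eventually (\<lambda>n. vdist_set (ell p) (x n) attaining < a) sequentially"
    proof eventually_elim
      case (elim n)
      then obtain m where m: "m \<in> attaining" "ell_norm p (\<lambda>i. x n i - m i) \<le> a / 2" by blast
      then show ?case using vdist_set_le[OF m(1), of "x n"] a by linarith
    qed
  qed
qed

section \<open>From maximizing sequences to strong subdifferentiability\<close>

text \<open>
  The condition on maximizing sequences in uniform form: a failure for every \<open>d = 1 / (k + 1)\<close>
  would produce a maximizing sequence staying away from the norm attaining set.
\<close>

lemma almost_attaining_near_attaining:
  assumes ne: "attaining \<noteq> {}"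
    and max: "\<And>x. maximizing_seq (ell p) (ell q) T x \<Longrightarrow> \<exists>r :: nat \<Rightarrow> nat. strict_mono r \<and>
              (\<lambda>i. vdist_set (ell p) (x (r i)) attaining) \<longlonglongrightarrow> 0"
    and h: "0 < h"
  shows "\<exists>d>0. \<forall>x\<in>unit_sphere (ell p). 1 - d < ell_norm q (T x) \<longrightarrow>
    (\<exists>m\<in>attaining. ell_norm p (\<lambda>n. x n - m n) < h)"
proof (rule ccontr)
  assume "\<not> ?thesis"
  then have "\<exists>x. x \<in> unit_sphere (ell p) \<and> 1 - d < ell_norm q (T x) \<and>
    (\<forall>m\<in>attaining. h \<le> ell_norm p (\<lambda>n. x n - m n))" if "0 < d" for d
    using that by (meson not_less)
  then have "\<forall>k. \<exists>x. x \<in> unit_sphere (ell p) \<and> 1 - 1 / real (Suc k) < ell_norm q (T x) \<and>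
    (\<forall>m\<in>attaining. h \<le> ell_norm p (\<lambda>n. x n - m n))" by simp
  from choice[OF this]
  obtain x where x: "\<And>k. x k \<in> unit_sphere (ell p)" "\<And>k. 1 - 1 / real (Suc k) < ell_norm q (T (x k))"
    "\<And>k m. m \<in> attaining \<Longrightarrow> h \<le> ell_norm p (\<lambda>n. x k n - m n)"
    by blast
  have "maximizing_seq (ell p) (ell q) T x" using x(1,2) by (rule maximizing_seqI)
  then obtain r :: "nat \<Rightarrow> nat" where "(\<lambda>i. vdist_set (ell p) (x (r i)) attaining) \<longlonglongrightarrow> 0"
    using max by blast
  from eventually_happens[OF order_tendstoD(2)[OF this h]]
  obtain i where i: "vdist_set (ell p) (x (r i)) attaining < h" by auto
  have "h \<le> vdist_set (ell p) (x (r i)) attaining"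
    unfolding vdist_set_def using ne x(3) by (intro cINF_greatest) (auto simp: vdist_def)
  with i show False by simp
qed

text \<open>
  The support function of the set of norming functionals \<open>S \<mapsto> j\<^bsub>Tm\<^esub>(S m)\<close> with \<open>m\<close> in the norm
  attaining set.
\<close>

definition support :: "((nat \<Rightarrow> 'a) \<Rightarrow> nat \<Rightarrow> 'a) \<Rightarrow> real" where
  "support S = (SUP m\<in>attaining. re_part (ell_pair q (T m) (S m)))"

lemma attaining_functional_bound:
  assumes "m \<in> attaining" "S \<in> bounded_ops (ell p) (ell q)"
  shows "norm (ell_pair q (T m) (S m)) \<le> vnorm ops S"
proof -
  have m: "m \<in> ell_set p" "ell_norm p m = 1" "ell_norm q (T m) = 1" using assms by (auto simp: attaining_iff)
  have "norm (ell_pair q (T m) (S m)) \<le> ell_norm q (S m)"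
    using m by (intro ell_pair_le op_closed[OF T] op_closed[OF assms(2)] q)
  also have "\<dots> \<le> vnorm ops S" using op_norm_bound[OF assms(2) m(1)] m by simp
  finally show ?thesis .
qed

lemma support_bdd:
  "bdd_above ((\<lambda>m. re_part (ell_pair q (T m) (S m))) ` attaining)" if "S \<in> bounded_ops (ell p) (ell q)"
  using attaining_functional_bound[OF _ that] re_part_le_norm order_trans by (intro bdd_aboveI2) blast

text \<open>
  A maximizing sequence of points \<open>m\<close> need not have a convergent subsequence, but the
  corresponding functionals have a cluster point.
\<close>

lemma support_attained:
  assumes ne: "attaining \<noteq> {}" and S: "S \<in> bounded_ops (ell p) (ell q)"
  obtains f where "f \<in> norming_functionals ops T" "re_part (f S) = support S"
proof -
  have "\<exists>m\<in>attaining. support S - 1 / real (Suc k) < re_part (ell_pair q (T m) (S m))" for k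
    using less_cSUP_iff[OF ne support_bdd[OF S], of "support S - 1 / real (Suc k)"]
    unfolding support_def[symmetric] by simp
  then obtain m where m: "\<And>k. m k \<in> attaining"
    "\<And>k. support S - 1 / real (Suc k) < re_part (ell_pair q (T (m k)) (S (m k)))" by metis
  have me: "m k \<in> ell_set p" "ell_norm p (m k) = 1" "ell_norm q (T (m k)) = 1" for k
    using m(1)[of k] by (auto simp: attaining_iff)
  have lim: "(\<lambda>k. re_part (ell_pair q (T (m k)) (S (m k)))) \<longlonglongrightarrow> support S"
  proof (rule tendsto_sandwich)
    show "(\<lambda>n. support S - 1 / real (Suc n)) \<longlonglongrightarrow> support S"
      using tendsto_diff[OF tendsto_const LIMSEQ_Suc[OF lim_1_over_n], of "support S"] by simp
    show "\<forall>\<^sub>F n in sequentially. support S - 1 / real (Suc n) \<le> re_part (ell_pair q (T (m n)) (S (m n)))"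
      using m(2) by (simp add: less_imp_le)
    show "\<forall>\<^sub>F n in sequentially. re_part (ell_pair q (T (m n)) (S (m n))) \<le> support S"
      using cSUP_upper[OF m(1) support_bdd[OF S]] by (simp add: support_def)
  qed simp
  show ?thesis
  proof (rule norming_functional_cluster_point[OF ops.seminormed_nspace_axioms, of T S "\<lambda>k R. ell_pair q (T (m k)) (R (m k))"])
    fix k R R' and c :: 'a assume "R \<in> vcarrier ops"
    then have R: "R \<in> bounded_ops (ell p) (ell q)" by simp
    show "norm (ell_pair q (T (m k)) (R (m k))) \<le> vnorm ops R"
      using attaining_functional_bound[OF m(1) R] .
    show "ell_pair q (T (m k)) (vscale ops c R (m k)) = c * ell_pair q (T (m k)) (R (m k))"
      using me(1) ell_pair_scale[OF op_closed[OF T me(1)] op_closed[OF R me(1)] q] by (simp add: op_space_def)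
    assume "R' \<in> vcarrier ops"
    then have R': "R' \<in> bounded_ops (ell p) (ell q)" by simp
    show "ell_pair q (T (m k)) (vadd ops R R' (m k)) = ell_pair q (T (m k)) (R (m k)) + ell_pair q (T (m k)) (R' (m k))"
      using me(1) ell_pair_add[OF op_closed[OF T me(1)] op_closed[OF R me(1)] op_closed[OF R' me(1)] q]
      by (simp add: op_space_def)
  next
    show "ell_pair q (T (m k)) (T (m k)) = 1" for k
      using ell_pair_self[OF op_closed[OF T me(1)] q] me(3) by simp
  qed (use T S norm_T lim that in auto)
qed

text \<open>
  Let \<open>x\<close> almost norm \<open>T + t S\<close>, hence be close to some \<open>m\<close> in the norm attaining set. The
  quotients of the convex function \<open>t \<mapsto> \<parallel>T x + t S x\<parallel>\<close> increase with \<open>t\<close>, so it suffices to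
  bound the one for a fixed \<open>s > t\<close>. There \<open>x\<close> can be replaced by \<open>m\<close> at a cost proportional to
  the distance over \<open>s\<close>, and uniform smoothness at the unit vector \<open>T m\<close> applies.
\<close>

lemma diff_quot_le_support:
  assumes ne: "attaining \<noteq> {}"
    and max: "\<And>x. maximizing_seq (ell p) (ell q) T x \<Longrightarrow> \<exists>r :: nat \<Rightarrow> nat. strict_mono r \<and>
              (\<lambda>i. vdist_set (ell p) (x (r i)) attaining) \<longlonglongrightarrow> 0"
    and e: "0 < e"
  shows "eventually (\<lambda>t. \<forall>S\<in>unit_ball ops. diff_quot t S < support S + e) (at_right 0)"
proof -
  have e4: "0 < e / 4" using e by simp
  obtain s where s: "0 < s" "\<And>y z :: nat \<Rightarrow> 'a.
      \<lbrakk>y \<in> ell_set q; z \<in> ell_set q; ell_norm q y = 1; ell_norm q z \<le> 1\<rbrakk>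
       \<Longrightarrow> ell_norm q (\<lambda>n. y n + of_real s * z n) \<le> 1 + s * re_part (ell_pair q y z) + s * (e/4)"
    using ell_uniformly_smooth[OF q e4] by blast
  \<comment> \<open>The distance from x to m that changes T x + s S x by at most s e / 4.\<close>
  define h where "h = s * e / (4 * (1 + s))"
  have h: "0 < h" "(1 + s) * h = s * (e/4)"
  proof -
    show "0 < h" using s(1) e by (simp add: h_def)
    have "4 * (1 + s) \<noteq> 0" using s(1) by simp
    from nonzero_eq_divide_eq[OF this, THEN iffD1, OF h_def]
    show "(1 + s) * h = s * (e/4)" by (simp add: algebra_simps)
  qed
  obtain d where d: "0 < d" "\<And>x. \<lbrakk>x \<in> unit_sphere (ell p); 1 - d < ell_norm q (T x)\<rbrakk> \<Longrightarrow>
    \<exists>m\<in>attaining. ell_norm p (\<lambda>n. x n - m n) < h"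
    using almost_attaining_near_attaining[OF ne max h(1)] by blast
  define t0 where "t0 = min s (min 1 d / (2 + e/4))"
  have "0 < t0" using s(1) d(1) e by (simp add: t0_def)
  then have "eventually (\<lambda>t. t \<in> {0<..<t0}) (at_right 0)" by (rule eventually_at_right_real)
  then show ?thesis
  proof (rule eventually_mono, intro ballI)
    fix t S assume "t \<in> {0<..<t0}" and S: "S \<in> unit_ball ops"
    then have t: "0 < t" "t < s" "t * (2 + e/4) < 1" "t * (2 + e/4) < d"
      using e by (auto simp: t0_def field_simps)
    have Sb: "S \<in> bounded_ops (ell p) (ell q)" using S by (simp add: unit_ball_def)
    define P where "P = vadd ops T (vscale ops (of_real t) S)"
    have P: "P \<in> bounded_ops (ell p) (ell q)" unfolding P_def using perturbation_closed[OF Sb] .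
    have "vnorm ops T \<le> vnorm ops P + t"
    proof -
      have "ell_norm q (T x) \<le> vnorm ops P + t" if x: "x \<in> unit_ball (ell p)" for x
      proof -
        have xe: "x \<in> ell_set p" "ell_norm p x \<le> 1" using x by (auto simp: unit_ball_def)
        have "T x = (\<lambda>n. P x n + of_real (- t) * S x n)"
          unfolding P_def perturbation_apply[OF xe(1)] by simp
        then have "ell_norm q (T x) \<le> ell_norm q (P x) + t * ell_norm q (S x)"
          using ell_norm_triangle[OF op_closed[OF P xe(1)] ell_scale_mem[OF op_closed[OF Sb xe(1)], of "of_real (- t)"] q]
            ell_norm_scale[OF op_closed[OF Sb xe(1)] q, of "of_real (- t)"] t(1)
          unfolding norm_of_real by simp
        also have "ell_norm q (P x) \<le> vnorm ops P" using op_norm_ge[OF P x] .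
        also have "t * ell_norm q (S x) \<le> t * 1"
          using norm_contraction[OF S xe(1)] xe t(1) by (intro mult_left_mono) auto
        finally show ?thesis by simp
      qed
      then show ?thesis by (rule op_norm_leI)
    qed
    then have Pn: "1 - t \<le> vnorm ops P" by (simp add: norm_T)
    define c where "c = vnorm ops P - t * (e/4)"
    have "0 \<le> c" "c < vnorm ops P" using Pn t e by (auto simp: c_def algebra_simps)
    then obtain x where x: "x \<in> unit_sphere (ell p)" "c < ell_norm q (P x)"
      using op_norm_approx_sphere[OF P] by blast
    have xe: "x \<in> ell_set p" "ell_norm p x = 1" using x(1) by (auto simp: unit_sphere_def)
    have Px: "P x = (\<lambda>n. T x n + of_real t * S x n)" unfolding P_def perturbation_apply[OF xe(1)] ..
    note Tx = op_closed[OF T xe(1)] and Sx = op_closed[OF Sb xe(1)]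
    have Sx1: "ell_norm q (S x) \<le> 1" using norm_contraction[OF S xe(1)] xe by simp
    have "ell_norm q (P x) \<le> ell_norm q (T x) + t * ell_norm q (S x)"
      unfolding Px using ell_norm_triangle[OF Tx ell_scale_mem[OF Sx] q, of "of_real t"]
        ell_norm_scale[OF Sx q, of "of_real t"] t(1) by simp
    also have "t * ell_norm q (S x) \<le> t * 1" using Sx1 t(1) by (intro mult_left_mono) auto
    finally have "1 - d < ell_norm q (T x)" using x(2) Pn t(4) by (simp add: c_def algebra_simps)
    from d(2)[OF x(1) this] obtain m where m: "m \<in> attaining" "ell_norm p (\<lambda>n. x n - m n) < h" by blast
    have me: "m \<in> ell_set p" "ell_norm p m = 1" "ell_norm q (T m) = 1" using m(1) by (auto simp: attaining_iff)
    note Tm = op_closed[OF T me(1)] and Sm = op_closed[OF Sb me(1)]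
    define y where "y = (\<lambda>n. x n - m n)"
    have y: "y \<in> ell_set p" "ell_norm p y < h" using xe me m p by (auto simp: y_def)
    note Ty = op_closed[OF T y(1)] and Sy = op_closed[OF Sb y(1)]
    have xmy: "x = (\<lambda>n. m n + y n)" by (simp add: y_def)
    have Txy: "T x = (\<lambda>n. T m n + T y n)" "S x = (\<lambda>n. S m n + S y n)"
      unfolding xmy using op_add[OF T me(1) y(1)] op_add[OF Sb me(1) y(1)] by simp_all
    define A where "A = (\<lambda>n. T m n + of_real s * S m n)"
    define B where "B = (\<lambda>n. T y n + of_real s * S y n)"
    have AB: "A \<in> ell_set q" "B \<in> ell_set q" unfolding A_def B_def
      by (intro ell_add_mem Tm Ty ell_scale_mem Sm Sy q)+
    have A: "ell_norm q A \<le> 1 + s * support S + s * (e/4)"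
    proof -
      have "ell_norm q A \<le> 1 + s * re_part (ell_pair q (T m) (S m)) + s * (e/4)"
        unfolding A_def using norm_contraction[OF S me(1)] me by (intro s(2) Tm Sm) auto
      also have "re_part (ell_pair q (T m) (S m)) \<le> support S"
        unfolding support_def by (rule cSUP_upper[OF m(1) support_bdd[OF Sb]])
      finally show ?thesis using s(1) by simp
    qed
    have B: "ell_norm q B \<le> s * (e/4)"
    proof -
      have "ell_norm q B \<le> ell_norm q (T y) + s * ell_norm q (S y)"
        unfolding B_def using ell_norm_triangle[OF Ty ell_scale_mem[OF Sy] q, of "of_real s"]
          ell_norm_scale[OF Sy q, of "of_real s"] s(1) by simp
      also have "\<dots> \<le> h + s * h"
        using norm_T_le[OF y(1)] norm_contraction[OF S y(1)] y(2) s(1) by (intro add_mono mult_left_mono) auto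
      also have "\<dots> = s * (e/4)" using h(2) by (simp add: distrib_right)
      finally show ?thesis .
    qed
    define C where "C = (\<lambda>n. T x n + of_real s * S x n)"
    have Cs: "C = (\<lambda>n. A n + B n)" unfolding C_def A_def B_def Txy by (simp add: algebra_simps)
    have C: "C \<in> ell_set q" unfolding Cs by (rule ell_add_mem[OF AB q])
    have C_le: "ell_norm q C \<le> 1 + s * support S + s * (e/4) + s * (e/4)"
      unfolding Cs using ell_norm_triangle[OF AB q] A B by linarith
    \<comment> \<open>T x + t S x is the convex combination of T x and T x + s S x with weight t / s.\<close>
    define l where "l = t / s"
    have l: "0 < l" "l \<le> 1" "l * s = t" using t s(1) by (auto simp: l_def)
    have "P x = (\<lambda>n. of_real (1 - l) * T x n + of_real l * C n)"
      unfolding Px C_def l(3)[symmetric] by (simp add: algebra_simps)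
    then have "ell_norm q (P x) \<le> (1 - l) * ell_norm q (T x) + l * ell_norm q C"
      using ell_norm_triangle[OF ell_scale_mem[OF Tx] ell_scale_mem[OF C] q, of "of_real (1 - l)" "of_real l"]
        ell_norm_scale[OF Tx q, of "of_real (1 - l)"] ell_norm_scale[OF C q, of "of_real l"] l
      unfolding norm_of_real by simp
    also have "\<dots> \<le> (1 - l) * 1 + l * (1 + s * support S + s * (e/4) + s * (e/4))"
      using norm_T_le[OF xe(1)] xe(2) C_le l by (intro add_mono mult_left_mono) auto
    also have "\<dots> = 1 + t * support S + t * (e/2)" unfolding l(3)[symmetric] by (simp add: algebra_simps)
    finally have "vnorm ops P - 1 < t * support S + (t * (e/2) + t * (e/4))"
      using x(2) unfolding c_def by linarith
    also have "t * (e/2) + t * (e/4) \<le> t * e" using t(1) e by simp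
    finally have "vnorm ops P - 1 < t * (support S + e)" by (simp add: distrib_left)
    then show "diff_quot t S < support S + e"
      using t(1) unfolding diff_quot_def P_def[symmetric] norm_T
      by (simp add: pos_divide_less_eq mult.commute)
  qed
qed

text \<open>
  The support function lies below every difference quotient because a norming functional attains
  it, and above the quotients up to an arbitrarily small error; hence it is the uniform limit.
  The same two bounds identify it as the maximum over all norming functionals.
\<close>

lemma maximizing_seq_converges_imp_ssd:
  assumes ne: "attaining \<noteq> {}"
    and max: "\<And>x. maximizing_seq (ell p) (ell q) T x \<Longrightarrow> \<exists>r :: nat \<Rightarrow> nat. strict_mono r \<and>
              (\<lambda>i. vdist_set (ell p) (x (r i)) attaining) \<longlonglongrightarrow> 0"
  shows "strongly_subdifferentiable ops T"
proof -
  have lower: "re_part (f S) \<le> diff_quot t S"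
    if "f \<in> norming_functionals ops T" "S \<in> unit_ball ops" "0 < t" for f S t
    unfolding diff_quot_def using that T
    by (intro norming_functional_le_quotient[OF ops.seminormed_nspace_axioms]) (auto simp: unit_ball_def)
  have up: "eventually (\<lambda>t. \<forall>S\<in>unit_ball ops. diff_quot t S < support S + e) (at_right 0)" if "0 < e" for e
    using diff_quot_le_support[OF ne max that] .
  have great: "(GREATEST r. r \<in> {re_part (f S) | f. f \<in> norming_functionals ops T}) = support S"
    if S: "S \<in> unit_ball ops" for S
  proof (rule Greatest_equality)
    have Sb: "S \<in> bounded_ops (ell p) (ell q)" using S by (simp add: unit_ball_def)
    obtain f where "f \<in> norming_functionals ops T" "re_part (f S) = support S"
      using support_attained[OF ne Sb] by blast
    then show "support S \<in> {re_part (f S) | f. f \<in> norming_functionals ops T}"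
      by (metis (mono_tags, lifting) mem_Collect_eq)
    fix r assume "r \<in> {re_part (f S) | f. f \<in> norming_functionals ops T}"
    then obtain f where f: "f \<in> norming_functionals ops T" "r = re_part (f S)" by blast
    show "r \<le> support S"
    proof (rule field_le_epsilon)
      fix e :: real assume "0 < e"
      from eventually_conj[OF up[OF this] eventually_at_right_less[of "0::real"]]
      obtain t where t: "0 < t" "\<forall>S\<in>unit_ball ops. diff_quot t S < support S + e"
        using eventually_happens'[OF trivial_limit_at_right_real] by blast
      then have "diff_quot t S < support S + e" using S by blast
      then show "r \<le> support S + e"
        using lower[OF f(1) S t(1)] f(2) by simp
    qed
  qed
  show ?thesis unfolding strongly_subdifferentiable_def diff_quot_def[symmetric]
  proof (rule uniform_limitI)
    fix e :: real assume e: "0 < e"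
    from up[OF e] eventually_at_right_less[of "0::real"]
    show "\<forall>\<^sub>F t in at_right 0. \<forall>S\<in>unit_ball ops. dist (diff_quot t S)
       (GREATEST r. r \<in> {re_part (f S) | f. f \<in> norming_functionals ops T}) < e"
    proof (eventually_elim, intro ballI)
      fix t S assume t: "\<forall>S\<in>unit_ball ops. diff_quot t S < support S + e" "0 < t" and S: "S \<in> unit_ball ops"
      have Sb: "S \<in> bounded_ops (ell p) (ell q)" using S by (simp add: unit_ball_def)
      obtain f where f: "f \<in> norming_functionals ops T" "re_part (f S) = support S"
        using support_attained[OF ne Sb] by blast
      have "support S \<le> diff_quot t S"
        using lower[OF f(1) S t(2)] f(2) by simp
      moreover have "diff_quot t S < support S + e" using t S by blast
      ultimately show "dist (diff_quot t S)
         (GREATEST r. r \<in> {re_part (f S) | f. f \<in> norming_functionals ops T}) < e"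
        unfolding great[OF S] dist_real_def by linarith
    qed
  qed
qed

theorem ssd_iff_maximizing_seq_converges:
  "strongly_subdifferentiable ops T \<longleftrightarrow>
     attaining \<noteq> {} \<and>
     (\<forall>x. maximizing_seq (ell p) (ell q) T x \<longrightarrow> (\<exists>r :: nat \<Rightarrow> nat. strict_mono r \<and>
        (\<lambda>i. vdist_set (ell p) (x (r i)) attaining) \<longlonglongrightarrow> 0))" (is "?L \<longleftrightarrow> ?R")
proof
  assume ?L
  then obtain G where G: "uniform_limit (unit_ball ops) diff_quot G (at_right 0)"
    unfolding strongly_subdifferentiable_def diff_quot_def[symmetric] by blast
  show ?R
    using ssd_imp_maximizing_seq_converges[OF G] by (auto intro!: exI[of _ id] simp: strict_mono_def)
next
  assume ?R
  then show ?L by (intro maximizing_seq_converges_imp_ssd) auto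
qed

end

theorem theorem2p16:
  fixes p q :: real
  assumes "1 < p" and "1 < q"
  shows
    "(\<forall>T :: (nat \<Rightarrow> real) \<Rightarrow> (nat \<Rightarrow> real).
        T \<in> vcarrier (op_space (ell p) (ell q)) \<and> vnorm (op_space (ell p) (ell q)) T = 1 \<longrightarrow>
        (strongly_subdifferentiable (op_space (ell p) (ell q)) T \<longleftrightarrow>
          norm_attaining_set (ell p) (ell q) T \<noteq> {} \<and>
          (\<forall>x. maximizing_seq (ell p) (ell q) T x \<longrightarrow>
            (\<exists>r :: nat \<Rightarrow> nat. strict_mono r \<and>
              (\<lambda>i. vdist_set (ell p) (x (r i)) (norm_attaining_set (ell p) (ell q) T))
                \<longlonglongrightarrow> 0)))) \<and>
     (\<forall>T :: (nat \<Rightarrow> complex) \<Rightarrow> (nat \<Rightarrow> complex).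
        T \<in> vcarrier (op_space (ell p) (ell q)) \<and> vnorm (op_space (ell p) (ell q)) T = 1 \<longrightarrow>
        (strongly_subdifferentiable (op_space (ell p) (ell q)) T \<longleftrightarrow>
          norm_attaining_set (ell p) (ell q) T \<noteq> {} \<and>
          (\<forall>x. maximizing_seq (ell p) (ell q) T x \<longrightarrow>
            (\<exists>r :: nat \<Rightarrow> nat. strict_mono r \<and>
              (\<lambda>i. vdist_set (ell p) (x (r i)) (norm_attaining_set (ell p) (ell q) T))
                \<longlonglongrightarrow> 0))))"
proof (intro conjI allI impI; elim conjE)
  fix T :: "(nat \<Rightarrow> real) \<Rightarrow> (nat \<Rightarrow> real)"
  assume "T \<in> vcarrier (op_space (ell p) (ell q))" "vnorm (op_space (ell p) (ell q)) T = 1"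
  then interpret norm_one_ell_op p q T
    using assms by unfold_locales (auto simp: op_space_def)
  show "strongly_subdifferentiable (op_space (ell p) (ell q)) T \<longleftrightarrow>
          norm_attaining_set (ell p) (ell q) T \<noteq> {} \<and>
          (\<forall>x. maximizing_seq (ell p) (ell q) T x \<longrightarrow>
            (\<exists>r :: nat \<Rightarrow> nat. strict_mono r \<and>
              (\<lambda>i. vdist_set (ell p) (x (r i)) (norm_attaining_set (ell p) (ell q) T))
                \<longlonglongrightarrow> 0))"
    by (rule ssd_iff_maximizing_seq_converges)
next
  fix T :: "(nat \<Rightarrow> complex) \<Rightarrow> (nat \<Rightarrow> complex)"
  assume "T \<in> vcarrier (op_space (ell p) (ell q))" "vnorm (op_space (ell p) (ell q)) T = 1"
  then interpret norm_one_ell_op p q T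
    using assms by unfold_locales (auto simp: op_space_def)
  show "strongly_subdifferentiable (op_space (ell p) (ell q)) T \<longleftrightarrow>
          norm_attaining_set (ell p) (ell q) T \<noteq> {} \<and>
          (\<forall>x. maximizing_seq (ell p) (ell q) T x \<longrightarrow>
            (\<exists>r :: nat \<Rightarrow> nat. strict_mono r \<and>
              (\<lambda>i. vdist_set (ell p) (x (r i)) (norm_attaining_set (ell p) (ell q) T))
                \<longlonglongrightarrow> 0))"
    by (rule ssd_iff_maximizing_seq_converges)
qed

end
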